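(* Let $\Sigma$ be a $(2,n)$-semitiling that is connected in codimension 1. Then $\Sigma$ extends to a complete tiling connected in codimension 1, i.e. there is a $(2,n)$-matroid tiling $\Sigma'\supseteq\Sigma$, connected in codimension 1, with $|\Sigma'|=\Delta(2,n)$.
   Context: $\Delta(2,n)=\mathrm{conv}\{1^A: A\subseteq[n],|A|=2\}\subset\mathbb{R}^n$, where $1^A$ is the indicator vector; it has dimension $n-1$. For a matroid $M$ on $[n]$, $\mathrm{BP}_M=\mathrm{conv}\{1^B:B\text{ a base}\}$. Two distinct polytopes are face-fitting if their intersection is empty or a common face. A $(2,n)$-semitiling is a finite collection $\Sigma$ of $(n-1)$-dimensional base polytopes of rank-2 matroids on $[n]$ such that for every codimension-2 cell $Q$ (a face of dimension $n-3$ of a member), the members having $Q$ as a face are pairwise face-fitting. A $(2,n)$-matroid tiling is such a collection whose members are pairwise face-fitting; $|\Sigma|$ is the union of the members. $\Sigma$ is connected in codimension 1 if any two members are joined by a sequence of members in which consecutive members intersect in a common facet. *)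

theory Defs
  imports "HOL-Analysis.Analysis"
begin

text \<open>The ground set $[n]$ is the universe of a finite type, so $n$ is its cardinality.\<close>

definition indicator_vec :: "'n::finite set \<Rightarrow> real ^ 'n" where
  "indicator_vec A = (\<chi> i. indicator A i)"

definition hypersimplex :: "nat \<Rightarrow> (real ^ 'n::finite) set" where
  "hypersimplex k = convex hull (indicator_vec ` {A. card A = k})"

text \<open>A matroid is given by its set of bases.\<close>

definition matroid_bases :: "'n::finite set set \<Rightarrow> bool" where
  "matroid_bases \<B> \<longleftrightarrow> \<B> \<noteq> {} \<and>
     (\<forall>B\<in>\<B>. \<forall>C\<in>\<B>. \<forall>x \<in> B - C. \<exists>y \<in> C - B. insert y (B - {x}) \<in> \<B>)"

definition matroid_bases_of_rank :: "nat \<Rightarrow> 'n::finite set set \<Rightarrow> bool" where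
  "matroid_bases_of_rank k \<B> \<longleftrightarrow> matroid_bases \<B> \<and> (\<forall>B\<in>\<B>. card B = k)"

definition base_polytope :: "'n::finite set set \<Rightarrow> (real ^ 'n) set" where
  "base_polytope \<B> = convex hull (indicator_vec ` \<B>)"

text \<open>The library relation \<open>face_of\<close> also counts the empty set and the polytope itself as
  faces. The relation below is used only for distinct polytopes, via \<open>pairwise\<close>.\<close>

definition face_fitting :: "'a::real_vector set \<Rightarrow> 'a set \<Rightarrow> bool" where
  "face_fitting P Q \<longleftrightarrow> P \<inter> Q = {} \<or> (P \<inter> Q face_of P \<and> P \<inter> Q face_of Q)"

definition full_dim_base_polytope :: "nat \<Rightarrow> (real ^ 'n::finite) set \<Rightarrow> bool" where
  "full_dim_base_polytope k P \<longleftrightarrow>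
     (\<exists>\<B>. matroid_bases_of_rank k \<B> \<and> P = base_polytope \<B>) \<and> aff_dim P = int CARD('n) - 1"

definition codim2_cell :: "(real ^ 'n::finite) set set \<Rightarrow> (real ^ 'n) set \<Rightarrow> bool" where
  "codim2_cell \<Sigma> Q \<longleftrightarrow> (\<exists>P\<in>\<Sigma>. Q face_of P) \<and> aff_dim Q = int CARD('n) - 3"

definition semitiling2 :: "(real ^ 'n::finite) set set \<Rightarrow> bool" where
  "semitiling2 \<Sigma> \<longleftrightarrow> finite \<Sigma> \<and> (\<forall>P\<in>\<Sigma>. full_dim_base_polytope 2 P) \<and>
     (\<forall>Q. codim2_cell \<Sigma> Q \<longrightarrow> pairwise face_fitting {P\<in>\<Sigma>. Q face_of P})"

definition matroid_tiling2 :: "(real ^ 'n::finite) set set \<Rightarrow> bool" where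
  "matroid_tiling2 \<Sigma> \<longleftrightarrow> semitiling2 \<Sigma> \<and> pairwise face_fitting \<Sigma>"

definition meet_in_common_facet :: "'a::euclidean_space set \<Rightarrow> 'a set \<Rightarrow> bool" where
  "meet_in_common_facet P Q \<longleftrightarrow> P \<inter> Q facet_of P \<and> P \<inter> Q facet_of Q"

definition connected_in_codim1 :: "'a::euclidean_space set set \<Rightarrow> bool" where
  "connected_in_codim1 \<Sigma> \<longleftrightarrow>
     (\<forall>P\<in>\<Sigma>. \<forall>Q\<in>\<Sigma>. \<exists>Ps. Ps \<noteq> [] \<and> set Ps \<subseteq> \<Sigma> \<and> hd Ps = P \<and> last Ps = Q \<and>
        successively meet_in_common_facet Ps)"

end

theory Submission imports Defs begin

text \<open>
  A full-dimensional rank-2 base polytope is cut out of the hypersimplex by the inequalities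
  $x(A) \le 1$, where $A$ runs over the at least three parallel classes of a loopless matroid, that
  is, over the blocks of a partition of $[n]$. Two such polytopes meet in a common facet iff
  some block $A$ of one partition has its complement as a block of the other. Two members of a
  semitiling sharing a block $A$ with $|A| \ge 2$ would share the facet $x(A) = 1$ and hence a
  codimension-2 cell, but they overlap on one side of that facet; so every such block determines
  its member. Along a walk through walls without backtracking the crossed blocks
  $S_0 \supset S_1 \supset \dots$ therefore strictly decrease, and the first and last of them separate
  the end polytopes so that these meet in the common face $x(S_0) = x(S_m) = 1$. To complete the
  tiling, cap every wall $x(A) = 1$ that has no second member with the partition into
  the complement of $A$ and the singletons of $A$. A point of the hypersimplex violating
  $x(A) \le 1$ is then located by crossing that wall, which strictly shrinks the violated block.
\<close>

subsection \<open>The base polytope of a partition\<close>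

text \<open>For a partition with at least two blocks, the separated pairs are the bases of the
  rank-2 matroid whose parallel classes are the blocks.\<close>

definition separated :: "'n set set \<Rightarrow> 'n \<Rightarrow> 'n \<Rightarrow> bool" where
  "separated \<pi> a b \<longleftrightarrow> (\<forall>A\<in>\<pi>. a \<in> A \<longrightarrow> b \<notin> A)"

text \<open>For a partition, the inequality of the block that contains \<open>i\<close> also gives
  \<open>x $ i \<le> 1\<close>, so the set lies in the hypersimplex.\<close>

definition block_polytope :: "'n::finite set set \<Rightarrow> (real ^ 'n) set" where
  "block_polytope \<pi> = {x. (\<forall>i. 0 \<le> x $ i) \<and> (\<Sum>i\<in>UNIV. x $ i) = 2 \<and> (\<forall>A\<in>\<pi>. (\<Sum>i\<in>A. x $ i) \<le> 1)}"

lemma inner_indicator_vec: "indicator_vec A \<bullet> x = (\<Sum>i\<in>A. x $ i)"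
  by (simp add: inner_vec_def indicator_vec_def indicator_def sum.If_cases)

lemma sum_indicator_vec: "(\<Sum>i\<in>A. indicator_vec B $ i) = real (card (A \<inter> B))"
  by (simp add: indicator_vec_def indicator_def sum.If_cases)

lemma indicator_vec_pair: "a \<noteq> b \<Longrightarrow> indicator_vec {a, b} = axis a 1 + axis b (1 :: real)"
  by (auto simp: indicator_vec_def vec_eq_iff axis_def)

lemma separated_sym: "separated \<pi> a b \<Longrightarrow> separated \<pi> b a"
  by (auto simp: separated_def)

lemma partition_block_exists: "partition_on UNIV \<pi> \<Longrightarrow> \<exists>A\<in>\<pi>. a \<in> A"
  by (auto simp: partition_on_def)

lemma partition_block_unique:
  "partition_on UNIV \<pi> \<Longrightarrow> A \<in> \<pi> \<Longrightarrow> B \<in> \<pi> \<Longrightarrow> a \<in> A \<Longrightarrow> a \<in> B \<Longrightarrow> A = B"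
  by (auto simp: partition_on_def disjoint_def)

lemma separated_imp_neq: "partition_on UNIV \<pi> \<Longrightarrow> separated \<pi> a b \<Longrightarrow> a \<noteq> b"
  using partition_block_exists[of \<pi> a] by (auto simp: separated_def)

lemma separatedI:
  "partition_on UNIV \<pi> \<Longrightarrow> A \<in> \<pi> \<Longrightarrow> a \<in> A \<Longrightarrow> b \<notin> A \<Longrightarrow> separated \<pi> a b"
  using partition_block_unique[of \<pi> A] by (auto simp: separated_def)

lemma not_separated_trans:
  assumes "partition_on UNIV \<pi>" "\<not> separated \<pi> a b" "\<not> separated \<pi> b c"
  shows "\<not> separated \<pi> a c"
proof -
  obtain A B where "A \<in> \<pi>" "a \<in> A" "b \<in> A" "B \<in> \<pi>" "b \<in> B" "c \<in> B"
    using assms(2,3) by (auto simp: separated_def)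
  then show ?thesis
    using partition_block_unique[OF assms(1), of A B b] by (auto simp: separated_def)
qed

lemma indicator_vec_pair_in_block_polytope_iff:
  assumes "partition_on UNIV \<pi>" "a \<noteq> b"
  shows "indicator_vec {a, b} \<in> block_polytope \<pi> \<longleftrightarrow> separated \<pi> a b"
proof -
  have nonneg: "0 \<le> indicator_vec {a, b} $ i" for i
    by (simp add: indicator_vec_def)
  have "card (A \<inter> {a, b}) \<le> 1 \<longleftrightarrow> \<not> (a \<in> A \<and> b \<in> A)" for A
    using assms(2) by (simp add: Int_insert_right)
  moreover have "indicator_vec {a, b} \<in> block_polytope \<pi> \<longleftrightarrow> (\<forall>A\<in>\<pi>. card (A \<inter> {a, b}) \<le> 1)"
    using assms(2) nonneg by (simp add: block_polytope_def sum_indicator_vec)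
  ultimately show ?thesis
    unfolding separated_def by blast
qed

lemma convex_block_polytope: "convex (block_polytope \<pi>)"
proof -
  have "block_polytope \<pi> = (\<Inter>i. {x. 0 \<le> axis i 1 \<bullet> x}) \<inter> {x. indicator_vec UNIV \<bullet> x = 2}
      \<inter> (\<Inter>A\<in>\<pi>. {x. indicator_vec A \<bullet> x \<le> 1})"
    by (auto simp: block_polytope_def inner_indicator_vec inner_axis')
  then show ?thesis
    by (simp only:) (intro convex_Int convex_INT convex_hyperplane convex_halfspace_le convex_halfspace_ge)
qed

lemma compact_block_polytope: "compact (block_polytope \<pi>)"
proof -
  have "block_polytope \<pi> = (\<Inter>i. {x. 0 \<le> x $ i}) \<inter> {x. (\<Sum>i\<in>UNIV. x $ i) = 2}
      \<inter> (\<Inter>A\<in>\<pi>. {x. (\<Sum>i\<in>A. x $ i) \<le> 1})"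
    by (auto simp: block_polytope_def)
  moreover have "closed \<dots>"
    by (intro closed_Int closed_INT ballI closed_Collect_le closed_Collect_eq continuous_intros)
  moreover have "block_polytope \<pi> \<subseteq> cbox 0 (\<chi> i. 2)"
  proof
    fix x assume x: "x \<in> block_polytope \<pi>"
    have "x $ i \<le> 2" for i
      using x member_le_sum[of i UNIV "($) x"] by (simp add: block_polytope_def)
    then show "x \<in> cbox 0 (\<chi> i. 2)"
      using x by (simp add: mem_box_cart block_polytope_def)
  qed
  ultimately show ?thesis
    using bounded_subset[OF bounded_cbox] by (simp add: compact_eq_bounded_closed)
qed

text \<open>A small move along \<open>axis a 1 - axis b 1\<close> in either direction stays inside:
  the total is kept, the two moved coordinates are positive, and a block whose sum changes contains
  exactly one of \<open>a\<close>, \<open>b\<close> and has slack.\<close>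

lemma block_polytope_not_extreme:
  assumes x: "x \<in> block_polytope \<pi>" and ab: "a \<noteq> b" "0 < x $ a" "0 < x $ b"
    and slack: "\<And>A. A \<in> \<pi> \<Longrightarrow> (a \<in> A \<longleftrightarrow> b \<in> A) \<or> (\<Sum>i\<in>A. x $ i) < 1"
  shows "\<not> x extreme_point_of block_polytope \<pi>"
proof -
  \<comment> \<open>\<open>\<epsilon>\<close> is the least of the finitely many positive slacks that
    bound the move.\<close>
  define E where "E = {x $ a, x $ b} \<union> (\<lambda>A. 1 - (\<Sum>i\<in>A. x $ i)) ` {A\<in>\<pi>. (\<Sum>i\<in>A. x $ i) < 1}"
  define \<epsilon> where "\<epsilon> = Min E"
  have E: "finite E" "E \<noteq> {}" "\<And>e. e \<in> E \<Longrightarrow> 0 < e"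
    using ab by (auto simp: E_def)
  have pos: "0 < \<epsilon>" unfolding \<epsilon>_def using E by simp
  have le: "e \<in> E \<Longrightarrow> \<epsilon> \<le> e" for e unfolding \<epsilon>_def using E by simp
  have xa: "\<epsilon> \<le> x $ a" and xb: "\<epsilon> \<le> x $ b" by (auto intro!: le simp: E_def)
  have xA: "A \<in> \<pi> \<Longrightarrow> (\<Sum>i\<in>A. x $ i) < 1 \<Longrightarrow> (\<Sum>i\<in>A. x $ i) + \<epsilon> \<le> 1" for A
    using le[of "1 - (\<Sum>i\<in>A. x $ i)"] by (auto simp: E_def)
  define d :: "real ^ 'a" where "d = axis a 1 - axis b 1"
  have d_nth: "d $ i = (if i = a then 1 else 0) - (if i = b then 1 else 0)" for i
    by (auto simp: d_def axis_def)
  have d_sum: "(\<Sum>i\<in>A. d $ i) = (if a \<in> A then 1 else 0) - (if b \<in> A then 1 else 0)" for A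
    by (simp add: d_nth sum_subtractf)
  have mem: "x + t *\<^sub>R d \<in> block_polytope \<pi>" if t: "\<bar>t\<bar> \<le> \<epsilon>" for t
  proof -
    have s: "(\<Sum>i\<in>A. (x + t *\<^sub>R d) $ i) = (\<Sum>i\<in>A. x $ i) + t * (\<Sum>i\<in>A. d $ i)" for A
      by (simp add: sum.distrib sum_distrib_left)
    have "0 \<le> (x + t *\<^sub>R d) $ i" for i
      using t xa xb x ab(1) by (auto simp: d_nth block_polytope_def)
    moreover have "(\<Sum>i\<in>UNIV. (x + t *\<^sub>R d) $ i) = 2"
      using x unfolding s d_sum by (simp add: block_polytope_def)
    moreover have "(\<Sum>i\<in>A. (x + t *\<^sub>R d) $ i) \<le> 1" if A: "A \<in> \<pi>" for A
    proof (cases "a \<in> A \<longleftrightarrow> b \<in> A")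
      case True then show ?thesis using x A unfolding s d_sum by (auto simp: block_polytope_def)
    next
      case False then show ?thesis using slack[OF A] xA[OF A] t unfolding s d_sum by auto
    qed
    ultimately show ?thesis by (simp add: block_polytope_def)
  qed
  have "(x + (-\<epsilon>) *\<^sub>R d) $ a \<noteq> (x + \<epsilon> *\<^sub>R d) $ a" using pos ab(1) by (simp add: d_nth)
  then have neq: "x + (-\<epsilon>) *\<^sub>R d \<noteq> x + \<epsilon> *\<^sub>R d" by metis
  have "midpoint (x + (-\<epsilon>) *\<^sub>R d) (x + \<epsilon> *\<^sub>R d) = x"
    by (simp add: midpoint_def flip: scaleR_add_left)
  then have "x \<in> open_segment (x + (-\<epsilon>) *\<^sub>R d) (x + \<epsilon> *\<^sub>R d)"
    using midpoint_in_open_segment neq by metis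
  then show ?thesis
    using mem[of "-\<epsilon>"] mem[of \<epsilon>] pos by (auto simp: extreme_point_of_def)
qed

text \<open>By \<open>block_polytope_not_extreme\<close>, each block contains at most one positive
  coordinate of an extreme point, and at most one coordinate is strictly between 0 and 1. As the
  total is the integer 2, none is.\<close>

lemma extreme_point_of_block_polytope:
  assumes part: "partition_on UNIV \<pi>" and ext: "x extreme_point_of block_polytope \<pi>"
  obtains a b where "separated \<pi> a b" "x = indicator_vec {a, b}"
proof -
  have x: "x \<in> block_polytope \<pi>" using ext by (simp add: extreme_point_of_def)
  have nonneg: "0 \<le> x $ i" for i using x by (simp add: block_polytope_def)
  have sum2: "(\<Sum>i\<in>UNIV. x $ i) = 2" using x by (simp add: block_polytope_def)
  have sep: "separated \<pi> a b" if "a \<noteq> b" "0 < x $ a" "0 < x $ b" for a b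
  proof (rule ccontr)
    assume "\<not> separated \<pi> a b"
    then obtain C where "C \<in> \<pi>" "a \<in> C" "b \<in> C" by (auto simp: separated_def)
    then have "(a \<in> A \<longleftrightarrow> b \<in> A)" if "A \<in> \<pi>" for A
      using partition_block_unique[OF part] that by blast
    then show False using block_polytope_not_extreme[OF x that] ext by blast
  qed
  have block_sum: "(\<Sum>i\<in>A. x $ i) = x $ a" if "A \<in> \<pi>" "a \<in> A" "0 < x $ a" for A a
  proof -
    have "x $ i = 0" if "i \<in> A - {a}" for i
      using sep[of a i] that \<open>A \<in> \<pi>\<close> \<open>a \<in> A\<close> \<open>0 < x $ a\<close> nonneg[of i]
      by (fastforce simp: separated_def)
    then show ?thesis using \<open>a \<in> A\<close> by (simp add: sum.remove[of A a])
  qed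
  have le1: "x $ a \<le> 1" for a
  proof (cases "0 < x $ a")
    case True
    then show ?thesis using partition_block_exists[OF part, of a] block_sum[of _ a] x
      by (force simp: block_polytope_def)
  qed simp
  have frac: "a = b" if "0 < x $ a" "x $ a < 1" "0 < x $ b" "x $ b < 1" for a b
  proof (rule ccontr)
    assume ab: "a \<noteq> b"
    have "(a \<in> A \<longleftrightarrow> b \<in> A) \<or> (\<Sum>i\<in>A. x $ i) < 1" if "A \<in> \<pi>" for A
      using block_sum[OF that, of a] block_sum[OF that, of b] \<open>0 < x $ a\<close> \<open>x $ a < 1\<close> \<open>0 < x $ b\<close> \<open>x $ b < 1\<close> by auto
    then show False
      using block_polytope_not_extreme[OF x ab \<open>0 < x $ a\<close> \<open>0 < x $ b\<close>] ext by blast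
  qed
  define U where "U = {i. x $ i = 1}"
  have sum_U: "(\<Sum>i\<in>U. x $ i) = card U" by (simp add: U_def)
  have no_frac: "\<not> (0 < x $ a \<and> x $ a < 1)" for a
  proof
    assume a: "0 < x $ a \<and> x $ a < 1"
    have "x $ i = 0" if "i \<in> - U - {a}" for i
      using frac[of a i] a that nonneg[of i] le1[of i] by (force simp: U_def)
    moreover have "a \<in> -U" using a by (simp add: U_def)
    ultimately have "(\<Sum>i\<in>-U. x $ i) = x $ a" by (simp add: sum.remove[of "-U" a])
    moreover have "(\<Sum>i\<in>UNIV. x $ i) = (\<Sum>i\<in>U. x $ i) + (\<Sum>i\<in>-U. x $ i)"
      using sum.subset_diff[of U UNIV "($) x"] by (simp add: Compl_eq_Diff_UNIV)
    ultimately have "2 = real (card U) + x $ a" using sum2 sum_U by simp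
    then have "1 < real (card U)" "real (card U) < 2" using a by linarith+
    then show False by simp
  qed
  have x_U: "x $ i = (if i \<in> U then 1 else 0)" for i
    using no_frac[of i] nonneg[of i] le1[of i] by (force simp: U_def)
  then have "2 = real (card U)" using sum2 by (simp add: sum.If_cases)
  then have "card U = 2" by linarith
  then obtain a b where U: "U = {a, b}" "a \<noteq> b" by (auto simp: card_2_iff)
  have "separated \<pi> a b" using sep[of a b] U x_U by simp
  moreover have "x = indicator_vec {a, b}"
    using x_U U by (simp add: vec_eq_iff indicator_vec_def indicator_def)
  ultimately show thesis using that by blast
qed

text \<open>Krein-Milman reduces the first inclusion to extreme points, which are indicators of
  separated pairs; for the second, the generators satisfy the inequalities.\<close>

lemma block_polytope_eq_base_polytope:
  assumes "partition_on UNIV \<pi>"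
  shows "block_polytope \<pi> = base_polytope {{a, b} | a b. separated \<pi> a b}"
proof
  have "block_polytope \<pi> = convex hull {x. x extreme_point_of block_polytope \<pi>}"
    by (rule Krein_Milman_Minkowski[OF compact_block_polytope convex_block_polytope])
  also have "\<dots> \<subseteq> base_polytope {{a, b} | a b. separated \<pi> a b}"
    unfolding base_polytope_def
    by (rule hull_mono) (blast elim: extreme_point_of_block_polytope[OF assms])
  finally show "block_polytope \<pi> \<subseteq> base_polytope {{a, b} | a b. separated \<pi> a b}" .
  show "base_polytope {{a, b} | a b. separated \<pi> a b} \<subseteq> block_polytope \<pi>"
    unfolding base_polytope_def
    using indicator_vec_pair_in_block_polytope_iff[OF assms] separated_imp_neq[OF assms]
    by (intro hull_minimal convex_block_polytope) auto
qed

lemma polytope_block_polytope: "partition_on UNIV \<pi> \<Longrightarrow> polytope (block_polytope \<pi>)"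
  by (simp add: block_polytope_eq_base_polytope base_polytope_def polytope_convex_hull)

text \<open>The affine hull misses the origin, so adding the origin raises the affine dimension by
  one. Dimensions can thus be computed from linear spans.\<close>

lemma aff_dim_eq_dim:
  assumes "\<And>x. x \<in> S \<Longrightarrow> (\<Sum>i\<in>UNIV. x $ i) = (2 :: real)"
  shows "aff_dim S = int (dim S) - 1"
proof -
  have "affine hull S \<subseteq> {x. indicator_vec UNIV \<bullet> x = 2}"
    using assms by (intro hull_minimal affine_hyperplane) (auto simp: inner_indicator_vec)
  then have "0 \<notin> affine hull S" by auto
  then have "aff_dim S + 1 = aff_dim (insert 0 S)" by (simp add: aff_dim_insert)
  also have "\<dots> = int (dim (insert 0 S))" by (intro aff_dim_zero hull_inc) simp
  finally show ?thesis by (simp add: dim_insert span_0)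
qed

subsection \<open>Facets\<close>

definition thick_partition :: "'n::finite set set \<Rightarrow> bool" where
  "thick_partition \<pi> \<longleftrightarrow> partition_on UNIV \<pi> \<and> 3 \<le> card \<pi>"

lemma thick_partitionD: "thick_partition \<pi> \<Longrightarrow> partition_on UNIV \<pi>"
  by (simp add: thick_partition_def)

lemma thick_partition_separated_outside:
  assumes "thick_partition \<pi>" "A \<in> \<pi>"
  obtains b c where "b \<notin> A" "c \<notin> A" "separated \<pi> b c"
proof -
  note part = thick_partitionD[OF assms(1)]
  have "\<not> card (\<pi> - {A}) \<le> Suc 0"
    using assms by (auto simp: thick_partition_def card_Diff_singleton)
  then obtain B C where BC: "B \<in> \<pi> - {A}" "C \<in> \<pi> - {A}" "B \<noteq> C"
    by (auto simp: card_le_Suc0_iff_eq)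
  then have "B \<noteq> {}" "C \<noteq> {}"
    using part by (auto simp: partition_on_def)
  then obtain b c where bc: "b \<in> B" "c \<in> C" by auto
  have "b \<notin> A" "c \<notin> A" "c \<notin> B"
    using partition_block_unique[OF part] BC bc assms(2) by (metis DiffE singletonI)+
  then show thesis
    using that separatedI[OF part _ bc(1)] BC by blast
qed

text \<open>A set is never the union of two proper equivalence relations on it.\<close>

lemma common_separated_pair:
  assumes \<pi>: "partition_on UNIV \<pi>" and \<rho>: "partition_on UNIV \<rho>"
    and "b \<in> S" "c \<in> S" "separated \<pi> b c" and "d \<in> S" "e \<in> S" "separated \<rho> d e"
  obtains p q where "p \<in> S" "q \<in> S" "separated \<pi> p q" "separated \<rho> p q"
proof (rule ccontr)
  assume "\<not> thesis"
  then have none: "\<not> separated \<rho> p q" if "p \<in> S" "q \<in> S" "separated \<pi> p q" for p q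
    using that \<open>\<And>p q. p \<in> S \<Longrightarrow> q \<in> S \<Longrightarrow> separated \<pi> p q \<Longrightarrow> separated \<rho> p q \<Longrightarrow> thesis\<close> by blast
  have bc: "\<not> separated \<rho> b c" using none assms by blast
  \<comment> \<open>A point \<open>f\<close> that \<open>\<rho>\<close> separates from
    \<open>b\<close> is also separated by \<open>\<rho>\<close> from \<open>c\<close>. Hence
    \<open>\<pi>\<close> joins it to both, which contradicts that \<open>\<pi>\<close> separates
    \<open>b\<close> and \<open>c\<close>. One of \<open>d\<close>, \<open>e\<close> is such a
    point.\<close>
  have "\<not> separated \<pi> b c" if f: "f \<in> S" "separated \<rho> b f" for f
  proof -
    have "separated \<rho> f c"
      using not_separated_trans[OF \<rho> bc, of f] f(2) separated_sym by metis
    then have "\<not> separated \<pi> f c" "\<not> separated \<pi> b f"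
      using none f assms by blast+
    then show ?thesis using not_separated_trans[OF \<pi>] by blast
  qed
  moreover have "separated \<rho> b d \<or> separated \<rho> b e"
    using not_separated_trans[OF \<rho>, of d b e] assms(8) separated_sym by metis
  ultimately show False using assms by blast
qed

section \<open>Dimension count by triangles of pairs\<close>

lemma axis_in_span:
  assumes "indicator_vec {a, b} \<in> span S" "indicator_vec {a, c} \<in> span S"
    "indicator_vec {b, c} \<in> span S" "a \<noteq> b" "a \<noteq> c" "b \<noteq> c"
  shows "axis a (1 :: real) \<in> span S"
proof -
  have "axis a (1 :: real) = (1/2) *\<^sub>R (indicator_vec {a, b} + indicator_vec {a, c} - indicator_vec {b, c})"
    using assms(4-6) by (simp add: indicator_vec_pair vec_eq_iff)
  also have "\<dots> \<in> span S"
    using assms by (intro span_mul span_diff span_add)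
  finally show ?thesis .
qed

lemma dim_full_if_axes:
  fixes S :: "(real ^ 'n) set"
  assumes "\<And>a. axis a 1 \<in> span S"
  shows "dim S = CARD('n)"
proof -
  have "Basis \<subseteq> span S" using assms by (auto simp: Basis_vec_def)
  then have "span Basis \<subseteq> span S" by (rule span_minimal) simp
  then have "span S = UNIV" by auto
  then show ?thesis by (metis DIM_cart DIM_real dim_eq_full mult.right_neutral)
qed

lemma aff_dim_block_polytope_subset:
  "S \<subseteq> block_polytope \<pi> \<Longrightarrow> aff_dim S = int (dim S) - 1"
  by (rule aff_dim_eq_dim) (auto simp: block_polytope_def)

text \<open>Each \<open>a\<close> forms a triangle with points \<open>b\<close>, \<open>c\<close> of
  two further blocks. Its edges are vertices of the polytope, and together they span the coordinate
  vector of \<open>a\<close>.\<close>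

lemma aff_dim_block_polytope:
  fixes \<pi> :: "'n::finite set set"
  assumes "thick_partition \<pi>"
  shows "aff_dim (block_polytope \<pi>) = int CARD('n) - 1"
proof -
  note part = thick_partitionD[OF assms]
  have "axis a 1 \<in> span (block_polytope \<pi>)" for a
  proof -
    obtain A where A: "A \<in> \<pi>" "a \<in> A" using partition_block_exists[OF part] by blast
    obtain b c where bc: "b \<notin> A" "c \<notin> A" "separated \<pi> b c"
      using thick_partition_separated_outside[OF assms A(1)] .
    then have sep: "separated \<pi> a b" "separated \<pi> a c" using separatedI[OF part A] by blast+
    show ?thesis
      using sep bc(3) separated_imp_neq[OF part] indicator_vec_pair_in_block_polytope_iff[OF part]
      by (intro axis_in_span[of a b _ c] span_base) blast+
  qed
  then show ?thesis
    by (simp add: aff_dim_block_polytope_subset[OF order_refl] dim_full_if_axes)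
qed

section \<open>Block faces, coordinate faces and common facets\<close>

lemma block_face_of:
  "A \<in> \<pi> \<Longrightarrow> block_polytope \<pi> \<inter> {x. indicator_vec A \<bullet> x = 1} face_of block_polytope \<pi>"
  by (intro face_of_Int_supporting_hyperplane_le convex_block_polytope)
    (simp add: inner_indicator_vec block_polytope_def)

lemma coordinate_face_of:
  "block_polytope \<pi> \<inter> {x. axis e 1 \<bullet> x = 0} face_of block_polytope \<pi>"
  by (intro face_of_Int_supporting_hyperplane_ge convex_block_polytope)
    (simp add: inner_axis' block_polytope_def)

text \<open>The face contains every pair with exactly one element in \<open>A\<close>. One further
  vertex, a separated pair \<open>b\<close>, \<open>c\<close> outside \<open>A\<close>, completes
  triangles at all points of \<open>A\<close> and makes the span full, so the face has codimension
  at most one. It is proper because it misses that vertex.\<close>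

lemma aff_dim_block_face:
  fixes \<pi> :: "'n::finite set set"
  assumes "thick_partition \<pi>" "A \<in> \<pi>"
  shows "aff_dim (block_polytope \<pi> \<inter> {x. indicator_vec A \<bullet> x = 1}) = int CARD('n) - 2"
proof -
  note part = thick_partitionD[OF assms(1)]
  let ?P = "block_polytope \<pi>" and ?F = "block_polytope \<pi> \<inter> {x. indicator_vec A \<bullet> x = 1}"
  obtain b c where bc: "b \<notin> A" "c \<notin> A" "separated \<pi> b c"
    using thick_partition_separated_outside[OF assms] .
  have bc_neq: "b \<noteq> c" using separated_imp_neq[OF part bc(3)] .
  let ?v = "indicator_vec {b, c} :: real ^ 'n"
  have v: "?v \<in> ?P" "?v \<notin> ?F"
    using indicator_vec_pair_in_block_polytope_iff[OF part bc_neq] bc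
    by (auto simp: inner_indicator_vec sum_indicator_vec)
  have mem: "indicator_vec {a, d} \<in> ?F" if "a \<in> A" "d \<notin> A" for a d
    using separatedI[OF part assms(2) that] that indicator_vec_pair_in_block_polytope_iff[OF part, of a d]
    by (auto simp: inner_indicator_vec sum_indicator_vec Int_insert_right)
  have axis_A: "axis a 1 \<in> span (insert ?v ?F)" if "a \<in> A" for a
    using mem[OF that] that bc bc_neq by (intro axis_in_span[of a b _ c] span_base) auto
  have "A \<noteq> {}" using assms(2) part by (auto simp: partition_on_def)
  then obtain a where a: "a \<in> A" by auto
  \<comment> \<open>Outside \<open>A\<close>, a coordinate vector is the indicator of a crossing
    pair minus the coordinate vector of its end in \<open>A\<close>.\<close>
  have "axis d 1 \<in> span (insert ?v ?F)" for d
  proof (cases "d \<in> A")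
    case False
    then have "axis d 1 = indicator_vec {a, d} - axis a (1 :: real)"
      using a by (subst indicator_vec_pair) auto
    then show ?thesis
      using span_diff[OF span_base[of _ "insert ?v ?F"] axis_A[OF a]] mem[OF a False] by auto
  qed (rule axis_A)
  then have "dim (insert ?v ?F) = CARD('n)" by (rule dim_full_if_axes)
  then have "CARD('n) \<le> dim ?F + 1" by (simp add: dim_insert split: if_splits)
  then have "int CARD('n) - 2 \<le> aff_dim ?F" using aff_dim_block_polytope_subset[of ?F \<pi>] by simp
  moreover have "aff_dim ?F < aff_dim ?P"
    using face_of_aff_dim_lt[OF convex_block_polytope block_face_of[OF assms(2)]] v by blast
  ultimately show ?thesis using aff_dim_block_polytope[OF assms(1)] by linarith
qed

text \<open>If \<open>F\<close> lay in none of these hyperplanes, all inequalities would be strict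
  at a relative interior point \<open>x\<close> of \<open>F\<close>, and the segment from any point
  \<open>p\<close> of the polytope to \<open>x\<close> could be prolonged beyond \<open>x\<close>.
  The face property would then put \<open>p\<close> in \<open>F\<close>.\<close>

lemma proper_face_of_block_polytope:
  assumes F: "F face_of block_polytope \<pi>" "F \<noteq> {}" "F \<noteq> block_polytope \<pi>"
  shows "(\<exists>A\<in>\<pi>. F \<subseteq> {x. indicator_vec A \<bullet> x = 1}) \<or> (\<exists>e. F \<subseteq> {x. axis e 1 \<bullet> x = 0})"
proof (rule ccontr)
  let ?P = "block_polytope \<pi>"
  assume neg: "\<not> ?thesis"
  obtain x where x: "x \<in> rel_interior F"
    using F face_of_imp_convex rel_interior_eq_empty by blast
  then have xF: "x \<in> F" using rel_interior_subset by blast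
  have FP: "F \<subseteq> ?P" using F(1) by (rule face_of_imp_subset)
  have xA: "(\<Sum>i\<in>A. x $ i) < 1" if A: "A \<in> \<pi>" for A
  proof (rule ccontr)
    assume "\<not> ?thesis"
    then have "x \<in> ?P \<inter> {x. indicator_vec A \<bullet> x = 1}"
      using subsetD[OF FP xF] A by (auto simp: block_polytope_def inner_indicator_vec not_less intro: antisym)
    then have "F \<subseteq> ?P \<inter> {x. indicator_vec A \<bullet> x = 1}"
      using x by (intro subset_of_face_of[OF block_face_of[OF A] FP]) blast
    then show False using neg A by blast
  qed
  have xe: "0 < x $ e" for e
  proof (rule ccontr)
    assume "\<not> ?thesis"
    then have "x \<in> ?P \<inter> {x. axis e 1 \<bullet> x = 0}"
      using subsetD[OF FP xF] by (auto simp: block_polytope_def inner_axis' not_less intro: antisym)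
    then have "F \<subseteq> ?P \<inter> {x. axis e 1 \<bullet> x = 0}"
      using x by (intro subset_of_face_of[OF coordinate_face_of FP]) blast
    then show False using neg by blast
  qed
  have "?P \<subseteq> F"
  proof
    fix p assume p: "p \<in> ?P"
    \<comment> \<open>\<open>y t\<close> lies beyond \<open>x\<close> on the ray from
      \<open>p\<close>; for small positive \<open>t\<close> it is still in the polytope.\<close>
    define y where "y t = x + t *\<^sub>R (x - p)" for t :: real
    have "((\<lambda>t. y t $ i) \<longlongrightarrow> x $ i) (at_right 0)" for i
      unfolding y_def by (auto intro!: tendsto_eq_intros)
    then have "\<forall>\<^sub>F t in at_right 0. 0 < y t $ i" for i
      using xe order_tendstoD(1) by blast
    then have "\<forall>\<^sub>F t in at_right 0. \<forall>i. 0 < y t $ i"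
      by (rule eventually_all_finite)
    moreover have "\<forall>\<^sub>F t in at_right 0. \<forall>A\<in>\<pi>. (\<Sum>i\<in>A. y t $ i) < 1"
    proof (rule eventually_ball_finite)
      show "\<forall>A\<in>\<pi>. \<forall>\<^sub>F t in at_right 0. (\<Sum>i\<in>A. y t $ i) < 1"
      proof
        fix A assume A: "A \<in> \<pi>"
        have "((\<lambda>t. \<Sum>i\<in>A. y t $ i) \<longlongrightarrow> (\<Sum>i\<in>A. x $ i)) (at_right 0)"
          unfolding y_def by (auto intro!: tendsto_eq_intros)
        then show "\<forall>\<^sub>F t in at_right 0. (\<Sum>i\<in>A. y t $ i) < 1"
          using xA[OF A] order_tendstoD(2) by blast
      qed
    qed simp
    moreover have "\<forall>\<^sub>F t in at_right (0 :: real). 0 < t"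
      by (rule eventually_at_right_less)
    ultimately have "\<forall>\<^sub>F t in at_right 0. 0 < t \<and> (\<forall>i. 0 < y t $ i) \<and> (\<forall>A\<in>\<pi>. (\<Sum>i\<in>A. y t $ i) < 1)"
      by eventually_elim blast
    then obtain t where t: "0 < t" "\<forall>i. 0 < y t $ i" "\<forall>A\<in>\<pi>. (\<Sum>i\<in>A. y t $ i) < 1"
      using eventually_happens'[OF trivial_limit_at_right_real] by blast
    have "(\<Sum>i\<in>UNIV. y t $ i) = (\<Sum>i\<in>UNIV. x $ i) + t * ((\<Sum>i\<in>UNIV. x $ i) - (\<Sum>i\<in>UNIV. p $ i))"
      by (simp add: y_def sum.distrib sum_subtractf flip: sum_distrib_left)
    then have "(\<Sum>i\<in>UNIV. y t $ i) = 2"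
      using p subsetD[OF FP xF] by (simp add: block_polytope_def)
    then have y: "y t \<in> ?P" using t by (simp add: block_polytope_def less_imp_le)
    show "p \<in> F"
    proof (cases "p = x")
      case False
      define u where "u = 1 / (1 + t)"
      have "u * t = 1 - u" using t(1) by (simp add: u_def field_simps)
      then have "u *\<^sub>R y t = u *\<^sub>R x + (1 - u) *\<^sub>R (x - p)"
        by (simp add: y_def scaleR_add_right)
      then have "x = (1 - u) *\<^sub>R p + u *\<^sub>R y t"
        by (simp add: algebra_simps)
      moreover have "p \<noteq> y t"
      proof
        assume "p = y t"
        then have "(1 + t) *\<^sub>R (x - p) = 0" by (simp add: y_def algebra_simps)
        then show False using t(1) False by simp
      qed
      moreover have "0 < u" "u < 1" using t(1) by (auto simp: u_def)
      ultimately have "x \<in> open_segment p (y t)" unfolding in_segment by blast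
      then show ?thesis using face_ofD[OF F(1) _ p y xF] by blast
    qed (use xF in simp)
  qed
  then show False using FP F(3) by blast
qed

text \<open>By dimension the intersection is the whole face x(A) = 1, so \<open>\<rho>\<close>
  separates all pairs crossing \<open>A\<close>. It separates no pair outside \<open>A\<close>:
  otherwise some pair outside \<open>A\<close> would be separated by both partitions and give a
  common vertex off the hyperplane.\<close>

lemma facet_in_block_hyperplane:
  fixes \<pi> :: "'n::finite set set"
  assumes \<pi>: "thick_partition \<pi>" and \<rho>: "thick_partition \<rho>" and A: "A \<in> \<pi>"
    and F: "block_polytope \<pi> \<inter> block_polytope \<rho> facet_of block_polytope \<pi>"
    and sub: "block_polytope \<pi> \<inter> block_polytope \<rho> \<subseteq> {x. indicator_vec A \<bullet> x = 1}"
  shows "- A \<in> \<rho>"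
proof -
  note part = thick_partitionD[OF \<pi>] thick_partitionD[OF \<rho>]
  let ?F = "block_polytope \<pi> \<inter> block_polytope \<rho>"
  let ?G = "block_polytope \<pi> \<inter> {x. indicator_vec A \<bullet> x = 1}"
  have "?F face_of ?G"
    by (rule face_of_subset[of ?F "block_polytope \<pi>"]) (use F sub in \<open>auto simp: facet_of_def\<close>)
  moreover have "aff_dim ?F = aff_dim ?G"
    using F by (simp add: facet_of_def aff_dim_block_polytope[OF \<pi>] aff_dim_block_face[OF \<pi> A])
  moreover have "convex ?G" by (intro convex_Int convex_block_polytope convex_hyperplane)
  ultimately have FG: "?F = ?G" using face_of_aff_dim_lt by (metis less_irrefl)
  have cross: "separated \<rho> a b" if "a \<in> A" "b \<notin> A" for a b
  proof -
    have "indicator_vec {a, b} \<in> ?G"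
      using separatedI[OF part(1) A that] that indicator_vec_pair_in_block_polytope_iff[OF part(1), of a b]
      by (auto simp: inner_indicator_vec sum_indicator_vec Int_insert_right)
    then have "indicator_vec {a, b} \<in> block_polytope \<rho>" using FG by blast
    then show ?thesis using indicator_vec_pair_in_block_polytope_iff[OF part(2), of a b] that by blast
  qed
  obtain b c where bc: "b \<notin> A" "c \<notin> A" "separated \<pi> b c"
    using thick_partition_separated_outside[OF \<pi> A] .
  obtain B where B: "B \<in> \<rho>" "b \<in> B" using partition_block_exists[OF part(2)] by blast
  have "- A \<subseteq> B"
  proof (rule ccontr)
    assume "\<not> - A \<subseteq> B"
    then obtain d where d: "d \<notin> A" "d \<notin> B" by auto
    obtain p q where pq: "p \<in> - A" "q \<in> - A" "separated \<pi> p q" "separated \<rho> p q"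
      using common_separated_pair[OF part, of b "- A" c b d] separatedI[OF part(2) B d(2)] bc d
      by (metis ComplI)
    then have "indicator_vec {p, q} \<in> ?F"
      using indicator_vec_pair_in_block_polytope_iff[OF part(1)] separated_imp_neq[OF part(1)]
        indicator_vec_pair_in_block_polytope_iff[OF part(2)] by blast
    then have "indicator_vec A \<bullet> (indicator_vec {p, q} :: real ^ 'n) = 1" using sub by blast
    then show False using pq(1,2) by (simp add: inner_indicator_vec sum_indicator_vec)
  qed
  moreover have "B \<subseteq> - A" using cross[OF _ bc(1)] B by (auto simp: separated_def)
  ultimately show ?thesis using B by (metis subset_antisym)
qed

text \<open>Otherwise the common facet fills a coordinate face x(e) = 0. For separated
  \<open>b\<close>, \<open>c\<close> outside the block of \<open>e\<close>, their pairs with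
  \<open>e\<close> are off the hyperplane, so \<open>\<rho>\<close> joins \<open>e\<close> to both,
  hence \<open>b\<close> to \<open>c\<close>. Yet the pair \<open>b\<close>, \<open>c\<close> is on
  the face and so in the polytope of \<open>\<rho>\<close>.\<close>

lemma meet_in_common_facet_imp_complementary_blocks:
  fixes \<pi> :: "'n::finite set set"
  assumes \<pi>: "thick_partition \<pi>" and \<rho>: "thick_partition \<rho>"
    and meet: "meet_in_common_facet (block_polytope \<pi>) (block_polytope \<rho>)"
  shows "\<exists>A\<in>\<pi>. - A \<in> \<rho>"
proof (rule ccontr)
  assume neg: "\<not> ?thesis"
  note part = thick_partitionD[OF \<pi>] thick_partitionD[OF \<rho>]
  let ?F = "block_polytope \<pi> \<inter> block_polytope \<rho>"
  have F: "?F facet_of block_polytope \<pi>" using meet by (simp add: meet_in_common_facet_def)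
  then have "?F \<noteq> block_polytope \<pi>" by (auto simp: facet_of_def)
  then obtain e where e: "?F \<subseteq> {x. axis e 1 \<bullet> x = 0}"
    using proper_face_of_block_polytope[of ?F \<pi>] F facet_in_block_hyperplane[OF \<pi> \<rho> _ F] neg
    unfolding facet_of_def by blast
  let ?G = "block_polytope \<pi> \<inter> {x. axis e 1 \<bullet> x = 0}"
  have "?F face_of ?G"
    by (rule face_of_subset[of ?F "block_polytope \<pi>"]) (use F e in \<open>auto simp: facet_of_def\<close>)
  moreover have conv: "convex ?G" by (intro convex_Int convex_block_polytope convex_hyperplane)
  \<comment> \<open>The coordinate face is proper, as it misses the pair \<open>e\<close>,
    \<open>b\<close>; its dimension is therefore at most that of a facet.\<close>
  moreover have "aff_dim ?G \<le> aff_dim ?F"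
  proof -
    obtain A where A: "A \<in> \<pi>" "e \<in> A" using partition_block_exists[OF part(1)] by blast
    obtain b c where bc: "b \<notin> A" "c \<notin> A" "separated \<pi> b c"
      using thick_partition_separated_outside[OF \<pi> A(1)] .
    have "indicator_vec {e, b} \<in> block_polytope \<pi>"
      using indicator_vec_pair_in_block_polytope_iff[OF part(1), of e b] separatedI[OF part(1) A bc(1)] A bc by auto
    moreover have "indicator_vec {e, b} \<notin> ?G"
      by (auto simp: inner_axis' indicator_vec_def)
    ultimately have "aff_dim ?G < aff_dim (block_polytope \<pi>)"
      using face_of_aff_dim_lt[OF convex_block_polytope coordinate_face_of[of \<pi> e]] by blast
    then show ?thesis using F by (simp add: facet_of_def)
  qed
  ultimately have FG: "?F = ?G" using face_of_aff_dim_lt[OF conv] by (metis linorder_not_less)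
  have meet_e: "\<not> separated \<rho> e b" if "separated \<pi> e b" for b
  proof
    assume "separated \<rho> e b"
    then have "indicator_vec {e, b} \<in> ?F"
      using indicator_vec_pair_in_block_polytope_iff[OF part(1)] separated_imp_neq[OF part(1)]
        indicator_vec_pair_in_block_polytope_iff[OF part(2)] that by blast
    then show False using e by (auto simp: inner_axis' indicator_vec_def)
  qed
  obtain A where A: "A \<in> \<pi>" "e \<in> A" using partition_block_exists[OF part(1)] by blast
  obtain b c where bc: "b \<notin> A" "c \<notin> A" "separated \<pi> b c"
    using thick_partition_separated_outside[OF \<pi> A(1)] .
  have "\<not> separated \<rho> e b" and ec: "\<not> separated \<rho> e c"
    using meet_e[OF separatedI[OF part(1) A]] bc by auto
  then have "\<not> separated \<rho> b e" by (auto dest: separated_sym)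
  then have "\<not> separated \<rho> b c" using ec by (rule not_separated_trans[OF part(2)])
  moreover have "indicator_vec {b, c} \<in> ?G"
    using indicator_vec_pair_in_block_polytope_iff[OF part(1) separated_imp_neq[OF part(1) bc(3)]] bc A
    by (auto simp: inner_axis' indicator_vec_def indicator_def)
  ultimately show False
    using FG indicator_vec_pair_in_block_polytope_iff[OF part(2) separated_imp_neq[OF part(1) bc(3)]] by blast
qed

section \<open>Intersections of polytopes with nested blocks\<close>

lemma sum_Compl_block_polytope:
  "x \<in> block_polytope \<pi> \<Longrightarrow> (\<Sum>i\<in>- A. x $ i) = 2 - (\<Sum>i\<in>A. x $ i)"
  using sum.subset_diff[of A UNIV "($) x"] by (simp add: block_polytope_def Compl_eq_Diff_UNIV)

lemma block_sum_mono:
  "x \<in> block_polytope \<pi> \<Longrightarrow> A \<subseteq> B \<Longrightarrow> (\<Sum>i\<in>A. x $ i) \<le> (\<Sum>i\<in>B. x $ i)"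
  by (rule sum_mono2) (auto simp: block_polytope_def)

text \<open>The block \<open>- T\<close> has sum 2 - 1, and every other block of
  \<open>\<rho>\<close> lies in \<open>T\<close>.\<close>

lemma nested_blocks_subset:
  assumes "partition_on UNIV \<rho>" "- T \<in> \<rho>" and x: "x \<in> block_polytope \<pi>" "(\<Sum>i\<in>T. x $ i) = 1"
  shows "x \<in> block_polytope \<rho>"
proof -
  have "(\<Sum>i\<in>B. x $ i) \<le> 1" if B: "B \<in> \<rho>" for B
  proof (cases "B = - T")
    case True then show ?thesis using sum_Compl_block_polytope[OF x(1), of T] x(2) by simp
  next
    case False
    then have "B \<subseteq> T" using partition_block_unique[OF assms(1) B assms(2)] by blast
    then show ?thesis using block_sum_mono[OF x(1)] x(2) by metis
  qed
  then show ?thesis using x(1) by (simp add: block_polytope_def)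
qed

text \<open>The two block inequalities give x(S) \<le> 1 and, by complementation, x(T) \<ge> 1,
  while \<open>T \<subseteq> S\<close> gives x(T) \<le> x(S); so both sums are 1.\<close>

lemma nested_blocks_Int:
  assumes \<pi>: "partition_on UNIV \<pi>" and \<rho>: "partition_on UNIV \<rho>"
    and ST: "S \<in> \<pi>" "- T \<in> \<rho>" "T \<subseteq> S"
  shows "block_polytope \<pi> \<inter> block_polytope \<rho>
    = block_polytope \<pi> \<inter> {x. indicator_vec S \<bullet> x = 1} \<inter> {x. indicator_vec T \<bullet> x = 1}"
proof (intro equalityI subsetI)
  fix x assume x: "x \<in> block_polytope \<pi> \<inter> block_polytope \<rho>"
  then have "(\<Sum>i\<in>S. x $ i) \<le> 1" "(\<Sum>i\<in>-T. x $ i) \<le> 1"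
    using ST by (auto simp: block_polytope_def)
  moreover have "(\<Sum>i\<in>T. x $ i) \<le> (\<Sum>i\<in>S. x $ i)" using x ST block_sum_mono by blast
  ultimately show "x \<in> block_polytope \<pi> \<inter> {x. indicator_vec S \<bullet> x = 1} \<inter> {x. indicator_vec T \<bullet> x = 1}"
    using x sum_Compl_block_polytope[of x \<pi> T] by (simp add: inner_indicator_vec)
next
  fix x assume "x \<in> block_polytope \<pi> \<inter> {x. indicator_vec S \<bullet> x = 1} \<inter> {x. indicator_vec T \<bullet> x = 1}"
  then show "x \<in> block_polytope \<pi> \<inter> block_polytope \<rho>"
    using nested_blocks_subset[OF \<rho> ST(2), of x \<pi>] by (simp add: inner_indicator_vec)
qed

text \<open>On the face x(S) = 1 the sum over \<open>T\<close> is at most 1, so the second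
  hyperplane supports that face; a face of a face is a face.\<close>

lemma nested_blocks_face_of:
  assumes \<pi>: "partition_on UNIV \<pi>" and \<rho>: "partition_on UNIV \<rho>"
    and ST: "S \<in> \<pi>" "- T \<in> \<rho>" "T \<subseteq> S"
  shows "block_polytope \<pi> \<inter> block_polytope \<rho> face_of block_polytope \<pi>"
proof -
  let ?F = "block_polytope \<pi> \<inter> {x. indicator_vec S \<bullet> x = 1}"
  have "?F \<inter> {x. indicator_vec T \<bullet> x = 1} face_of ?F"
    using block_sum_mono[OF _ ST(3)]
    by (intro face_of_Int_supporting_hyperplane_le convex_Int convex_block_polytope convex_hyperplane)
      (fastforce simp: inner_indicator_vec)
  then show ?thesis
    unfolding nested_blocks_Int[OF assms] using block_face_of[OF ST(1)] face_of_trans by blast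
qed

lemma nested_blocks_face_fitting:
  assumes "partition_on UNIV \<pi>" "partition_on UNIV \<rho>" "S \<in> \<pi>" "- T \<in> \<rho>" "T \<subseteq> S"
  shows "face_fitting (block_polytope \<pi>) (block_polytope \<rho>)"
  \<comment> \<open>The situation is symmetric: complementation turns \<open>T \<subseteq> S\<close>
    into \<open>- S \<subseteq> - T\<close>.\<close>
  using nested_blocks_face_of[OF assms] nested_blocks_face_of[of \<rho> \<pi> "- T" "- S"] assms
  by (simp add: face_fitting_def Int_commute)

lemma complementary_blocks_meet_in_common_facet:
  fixes \<pi> :: "'n::finite set set"
  assumes \<pi>: "thick_partition \<pi>" and \<rho>: "thick_partition \<rho>" and A: "A \<in> \<pi>" "- A \<in> \<rho>"
  shows "meet_in_common_facet (block_polytope \<pi>) (block_polytope \<rho>)"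
proof -
  note part = thick_partitionD[OF \<pi>] thick_partitionD[OF \<rho>]
  let ?F = "block_polytope \<pi> \<inter> block_polytope \<rho>"
  have "?F = block_polytope \<pi> \<inter> {x. indicator_vec A \<bullet> x = 1}"
    using nested_blocks_Int[OF part A] by auto
  then have dim: "aff_dim ?F = int CARD('n) - 2"
    using aff_dim_block_face[OF \<pi> A(1)] by simp
  \<comment> \<open>A facet must be nonempty: two separated points give n \<ge> 2, hence dimension
    at least 0.\<close>
  obtain b c where "b \<notin> A" "c \<notin> A" "separated \<pi> b c"
    using thick_partition_separated_outside[OF \<pi> A(1)] .
  then have "card {b, c} = 2" using separated_imp_neq[OF part(1)] by simp
  then have "2 \<le> CARD('n)" using card_mono[of UNIV "{b, c}"] by simp
  then have "?F \<noteq> {}" using dim by auto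
  then show ?thesis
    using dim nested_blocks_face_of[OF part A] nested_blocks_face_of[OF part(2,1) A(2), of "- A"] A
    by (simp add: meet_in_common_facet_def facet_of_def aff_dim_block_polytope \<pi> \<rho> Int_commute)
qed

text \<open>Both polytopes have the facet x(A) = 1 and lie on the same side of it. A facet of this
  facet is a codimension-2 cell, so distinct polytopes would be face-fitting. But they share a
  vertex off the facet, so their intersection is full-dimensional, and a full-dimensional face is
  the whole polytope.\<close>

lemma shared_block_imp_eq:
  fixes \<Sigma> :: "(real ^ 'n::finite) set set"
  assumes semi: "semitiling2 \<Sigma>" and \<pi>: "thick_partition \<pi>" and \<rho>: "thick_partition \<rho>"
    and \<Sigma>: "block_polytope \<pi> \<in> \<Sigma>" "block_polytope \<rho> \<in> \<Sigma>"
    and A: "A \<in> \<pi>" "A \<in> \<rho>" "2 \<le> card A"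
  shows "block_polytope \<pi> = block_polytope \<rho>"
proof (rule ccontr)
  let ?P = "block_polytope \<pi>" and ?R = "block_polytope \<rho>"
  assume neq: "?P \<noteq> ?R"
  note part = thick_partitionD[OF \<pi>] thick_partitionD[OF \<rho>]
  let ?F = "?P \<inter> {x. indicator_vec A \<bullet> x = 1}"
  have sum_Compl: "(\<Sum>i\<in>-A. x $ i) = 1" if "x \<in> block_polytope \<sigma>" "indicator_vec A \<bullet> x = 1" for x \<sigma>
    using sum_Compl_block_polytope[OF that(1), of A] that(2) by (simp add: inner_indicator_vec)
  have F_eq: "?F = ?R \<inter> {x. indicator_vec A \<bullet> x = 1}"
    using nested_blocks_subset[OF part(1), of "- A"] nested_blocks_subset[OF part(2), of "- A"] A sum_Compl
    by auto
  have F_face: "?F face_of ?P" "?F face_of ?R"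
    using block_face_of[OF A(1)] block_face_of[OF A(2)] F_eq by auto
  obtain b c where bc: "b \<notin> A" "c \<notin> A" "separated \<pi> b c"
    using thick_partition_separated_outside[OF \<pi> A(1)] .
  have "b \<noteq> c" using separated_imp_neq[OF part(1) bc(3)] .
  \<comment> \<open>\<open>A\<close> and two points outside it give n \<ge> 4, so the facet has
    positive dimension and itself has a facet.\<close>
  have "card (A \<union> {b, c}) \<le> CARD('n)" by (rule card_mono) auto
  moreover have "card (A \<union> {b, c}) = card A + 2"
    using bc(1,2) \<open>b \<noteq> c\<close> by (subst card_Un_disjoint) auto
  ultimately have "4 \<le> CARD('n)" using A(3) by linarith
  then have "0 < aff_dim ?F" using aff_dim_block_face[OF \<pi> A(1)] by simp
  moreover have "polytope ?F"
    using face_of_polytope_polytope[OF polytope_block_polytope[OF part(1)] F_face(1)] .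
  ultimately obtain Q where Q: "Q facet_of ?F" using polytope_facet_exists by blast
  have Q_face: "Q face_of ?P" "Q face_of ?R"
    using Q F_face face_of_trans by (auto simp: facet_of_def)
  moreover have "aff_dim Q = int CARD('n) - 3"
    using Q aff_dim_block_face[OF \<pi> A(1)] by (simp add: facet_of_def)
  ultimately have "codim2_cell \<Sigma> Q" using \<Sigma>(1) by (auto simp: codim2_cell_def)
  then have "face_fitting ?P ?R"
    using semi \<Sigma> Q_face neq by (auto simp: semitiling2_def pairwise_def)
  \<comment> \<open>This pair rules out an empty intersection and shows that the intersection is
    larger than \<open>?F\<close>.\<close>
  moreover obtain p q where pq: "p \<in> - A" "q \<in> - A" "separated \<pi> p q" "separated \<rho> p q"
  proof -
    obtain d e where "d \<notin> A" "e \<notin> A" "separated \<rho> d e"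
      using thick_partition_separated_outside[OF \<rho> A(2)] .
    then show thesis using common_separated_pair[OF part, of b "- A" c d e] bc that by auto
  qed
  let ?v = "indicator_vec {p, q} :: real ^ 'n"
  have v: "?v \<in> ?P \<inter> ?R"
    using pq separated_imp_neq[OF part(1) pq(3)] indicator_vec_pair_in_block_polytope_iff part by blast
  ultimately have PR: "?P \<inter> ?R face_of ?P" "?P \<inter> ?R face_of ?R" by (auto simp: face_fitting_def)
  have "?v \<notin> ?F" using pq by (simp add: inner_indicator_vec sum_indicator_vec)
  moreover have "?F face_of ?P \<inter> ?R"
    by (rule face_of_subset[OF F_face(1)]) (use F_eq in auto)
  ultimately have "aff_dim ?F < aff_dim (?P \<inter> ?R)"
    using v by (metis convex_Int convex_block_polytope face_of_aff_dim_lt)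
  then have full: "int CARD('n) - 1 \<le> aff_dim (?P \<inter> ?R)" using aff_dim_block_face[OF \<pi> A(1)] by simp
  have "?P \<inter> ?R = ?P"
    using face_of_aff_dim_lt[OF convex_block_polytope PR(1)] full aff_dim_block_polytope[OF \<pi>] by linarith
  moreover have "?P \<inter> ?R = ?R"
    using face_of_aff_dim_lt[OF convex_block_polytope PR(2)] full aff_dim_block_polytope[OF \<rho>] by linarith
  ultimately show False using neq by simp
qed

section \<open>Recovering a partition from its polytope\<close>

lemma partition_eq_separated:
  assumes "partition_on UNIV \<pi>"
  shows "\<pi> = range (\<lambda>a. {b. \<not> separated \<pi> a b})"
proof -
  have block: "A = {b. \<not> separated \<pi> a b}" if "A \<in> \<pi>" "a \<in> A" for A a
    using that separatedI[OF assms that] by (auto simp: separated_def)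
  show ?thesis
  proof (intro equalityI subsetI)
    fix A assume "A \<in> \<pi>"
    moreover from this obtain a where "a \<in> A" using assms by (metis partition_on_def all_not_in_conv)
    ultimately show "A \<in> range (\<lambda>a. {b. \<not> separated \<pi> a b})" using block by auto
  next
    fix A assume "A \<in> range (\<lambda>a. {b. \<not> separated \<pi> a b})"
    then obtain a where "A = {b. \<not> separated \<pi> a b}" by auto
    then show "A \<in> \<pi>" using partition_block_exists[OF assms, of a] block by metis
  qed
qed

text \<open>The indicators of pairs in the polytope show which pairs are separated, and the blocks
  are the classes of the relation of not being separated.\<close>

lemma block_polytope_inject:
  assumes \<pi>: "partition_on UNIV \<pi>" and \<rho>: "partition_on UNIV \<rho>"
    and eq: "block_polytope \<pi> = block_polytope \<rho>"
  shows "\<pi> = \<rho>"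
proof -
  have "separated \<pi> a b \<longleftrightarrow> separated \<rho> a b" for a b
    using indicator_vec_pair_in_block_polytope_iff[OF \<pi>, of a b] separated_imp_neq[OF \<pi>, of a b]
      indicator_vec_pair_in_block_polytope_iff[OF \<rho>, of a b] separated_imp_neq[OF \<rho>, of a b] eq
    by auto
  then show ?thesis using partition_eq_separated[OF \<pi>] partition_eq_separated[OF \<rho>] by simp
qed

subsection \<open>Rank-2 matroids and partitions\<close>

lemma matroid_bases_separated_pairs:
  assumes "thick_partition \<pi>"
  shows "matroid_bases {{a, b} | a b. separated \<pi> a b}" (is "matroid_bases ?\<B>")
proof -
  note part = thick_partitionD[OF assms]
  have "\<pi> \<noteq> {}" using assms by (auto simp: thick_partition_def)
  then obtain A where "A \<in> \<pi>" by auto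
  then obtain b c where "b \<notin> A" "c \<notin> A" "separated \<pi> b c"
    by (rule thick_partition_separated_outside[OF assms])
  then have "?\<B> \<noteq> {}" by blast
  moreover have "\<exists>y\<in>C - B. insert y (B - {x}) \<in> ?\<B>" if BC: "B \<in> ?\<B>" "C \<in> ?\<B>" and x: "x \<in> B - C" for B C x
  proof -
    obtain b where b: "B = {x, b}" "separated \<pi> x b"
      using BC(1) x by (auto dest: separated_sym)
    obtain c d where cd: "C = {c, d}" "separated \<pi> c d" using BC(2) by auto
    \<comment> \<open>\<open>b\<close> is what remains of \<open>B\<close>. As \<open>c\<close> and
      \<open>d\<close> are separated, they are not both in its block, so one of them can replace
      \<open>x\<close>.\<close>
    have "separated \<pi> c b \<or> separated \<pi> b d"
      using not_separated_trans[OF part, of c b d] cd(2) by blast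
    then obtain y where y: "y \<in> C" "separated \<pi> y b"
      using cd(1) by (auto dest: separated_sym)
    have "y \<noteq> b" "x \<noteq> b" using separated_imp_neq[OF part] y b by blast+
    then have "y \<in> C - B" "insert y (B - {x}) = {y, b}" using b x y by auto
    then show ?thesis using y(2) by (intro bexI[of _ y]) auto
  qed
  ultimately show ?thesis unfolding matroid_bases_def by blast
qed

lemma full_dim_block_polytope:
  fixes \<pi> :: "'n::finite set set"
  assumes "thick_partition \<pi>"
  shows "full_dim_base_polytope 2 (block_polytope \<pi>)"
proof -
  note part = thick_partitionD[OF assms]
  have "matroid_bases_of_rank 2 {{a, b} | a b. separated \<pi> a b}"
    using matroid_bases_separated_pairs[OF assms] separated_imp_neq[OF part]
    by (auto simp: matroid_bases_of_rank_def)
  then show ?thesis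
    using block_polytope_eq_base_polytope[OF part] aff_dim_block_polytope[OF assms]
    by (auto simp: full_dim_base_polytope_def)
qed

text \<open>The polytope spans the whole space, so its generators satisfy no nontrivial homogeneous
  linear equation. This serves to exclude loops and partitions with too few classes.\<close>

lemma full_dim_base_polytope_not_in_hyperplane:
  fixes \<B> :: "'n::finite set set"
  assumes full: "full_dim_base_polytope 2 (base_polytope \<B>)" and card: "\<And>B. B \<in> \<B> \<Longrightarrow> card B = 2"
    and "v \<noteq> 0" "\<And>B. B \<in> \<B> \<Longrightarrow> v \<bullet> indicator_vec B = 0"
  shows False
proof -
  let ?P = "base_polytope \<B>"
  have "?P \<subseteq> {x. v \<bullet> x = 0}" unfolding base_polytope_def
    using assms(4) by (intro hull_minimal convex_hyperplane) auto
  then have "dim ?P \<le> CARD('n) - 1"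
    using dim_subset[of ?P "{x. v \<bullet> x = 0}"] dim_hyperplane[OF assms(3)] by simp
  moreover have "?P \<subseteq> {x. indicator_vec UNIV \<bullet> x = 2}" unfolding base_polytope_def
    using card by (intro hull_minimal convex_hyperplane) (auto simp: inner_indicator_vec sum_indicator_vec)
  then have "aff_dim ?P = int (dim ?P) - 1"
    by (intro aff_dim_eq_dim) (auto simp: inner_indicator_vec)
  moreover have "aff_dim ?P = int CARD('n) - 1" using full by (simp add: full_dim_base_polytope_def)
  ultimately show False using zero_less_card_finite[where 'a = 'n] by linarith
qed

text \<open>Without loops, being parallel is an equivalence relation, and the bases are the pairs
  from different classes. A loop \<open>e\<close> would force x(e) = 0, and fewer than three classes
  would force x(A) = x(- A) for a class \<open>A\<close>; full dimension excludes both.\<close>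

lemma full_dim_base_polytope_imp_block_polytope:
  fixes P :: "(real ^ 'n::finite) set"
  assumes full: "full_dim_base_polytope 2 P"
  obtains \<pi> where "thick_partition \<pi>" "P = block_polytope \<pi>"
proof -
  obtain \<B> where \<B>: "matroid_bases \<B>" and card: "\<And>B. B \<in> \<B> \<Longrightarrow> card B = 2" and P: "P = base_polytope \<B>"
    using full by (auto simp: full_dim_base_polytope_def matroid_bases_of_rank_def)
  have loopless: "\<exists>d. {e, d} \<in> \<B>" for e
  proof (rule ccontr)
    assume neg: "\<not> ?thesis"
    have "axis e 1 \<bullet> (indicator_vec B :: real ^ 'n) = 0" if "B \<in> \<B>" for B
    proof -
      have "e \<notin> B" using card[OF that] neg that by (auto simp: card_2_iff insert_commute)
      then show ?thesis by (simp add: inner_axis' indicator_vec_def)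
    qed
    then show False
      using full_dim_base_polytope_not_in_hyperplane[of \<B> "axis e 1"] full card P by (simp add: axis_eq_0_iff)
  qed
  \<comment> \<open>This is parallelism. It contains the diagonal, since \<open>{a, a}\<close> has
    one element and is no base.\<close>
  define r where "r = {(a, b). {a, b} \<notin> \<B>}"
  have "trans r"
  proof (rule transI)
    fix a b c assume "(a, b) \<in> r" "(b, c) \<in> r"
    then have ab: "{b, a} \<notin> \<B>" and bc: "{b, c} \<notin> \<B>" by (auto simp: r_def insert_commute)
    obtain d where d: "{b, d} \<in> \<B>" using loopless by blast
    then have "b \<noteq> d" using card[OF d] by auto
    have "{a, c} \<notin> \<B>"
    proof
      assume ac: "{a, c} \<in> \<B>"
      \<comment> \<open>Exchanging \<open>d\<close> against \<open>{a, c}\<close> keeps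
        \<open>b\<close>, so \<open>{a, b}\<close> or \<open>{b, c}\<close> would be a base.\<close>
      have "d \<in> {b, d} - {a, c}" using d ab bc by auto
      then obtain y where "y \<in> {a, c}" "insert y ({b, d} - {d}) \<in> \<B>"
        using \<B> d ac unfolding matroid_bases_def by blast
      then show False using ab bc \<open>b \<noteq> d\<close> by (auto simp: insert_commute insert_Diff_if)
    qed
    then show "(a, c) \<in> r" by (simp add: r_def)
  qed
  moreover have "refl r" using card by (fastforce simp: refl_on_def r_def)
  moreover have "sym r" by (auto simp: sym_def r_def insert_commute)
  ultimately have equiv: "equiv UNIV r" by (auto simp: equiv_def)
  define \<pi> where "\<pi> = UNIV // r"
  have part: "partition_on UNIV \<pi>" unfolding \<pi>_def using equiv by (rule partition_on_quotient)
  have sep: "separated \<pi> a b \<longleftrightarrow> {a, b} \<in> \<B>" for a b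
  proof -
    have "a \<in> A \<and> b \<in> A \<Longrightarrow> (a, b) \<in> r" if "A \<in> \<pi>" for A
      using that in_quotient_imp_in_rel[OF equiv] unfolding \<pi>_def by blast
    moreover have "a \<in> r `` {a}" "r `` {a} \<in> \<pi>"
      using equiv unfolding \<pi>_def by (auto simp: equiv_def refl_on_def quotient_def)
    ultimately show ?thesis by (auto simp: separated_def r_def)
  qed
  have "\<B> = {{a, b} | a b. separated \<pi> a b}"
    unfolding sep using card by (auto simp: card_2_iff) metis
  then have P_eq: "P = block_polytope \<pi>" using block_polytope_eq_base_polytope[OF part] P by simp
  have "3 \<le> card \<pi>"
  proof (rule ccontr)
    assume "\<not> 3 \<le> card \<pi>"
    then have small: "card \<pi> \<le> 2" by simp
    obtain A where A: "A \<in> \<pi>" using partition_block_exists[OF part] by blast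
    \<comment> \<open>With at most two classes every base has exactly one element in
      \<open>A\<close>, so this functional vanishes on all bases.\<close>
    define v :: "real ^ 'n" where "v = indicator_vec A - indicator_vec (- A)"
    have "v \<bullet> indicator_vec B = 0" if B: "B \<in> \<B>" for B
    proof -
      obtain a b where ab: "B = {a, b}" "a \<noteq> b" using card[OF B] by (auto simp: card_2_iff)
      then have "separated \<pi> a b" using sep B by simp
      then have not_both: "\<not> (a \<in> A \<and> b \<in> A)" using A by (auto simp: separated_def)
      have "a \<in> A \<or> b \<in> A"
      proof (rule ccontr)
        assume out: "\<not> ?thesis"
        obtain C D where CD: "C \<in> \<pi>" "a \<in> C" "D \<in> \<pi>" "b \<in> D" using partition_block_exists[OF part] by metis
        then have "C \<noteq> D" using \<open>separated \<pi> a b\<close> by (auto simp: separated_def)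
        then have "card {A, C, D} = 3" using out CD by (auto simp: card_insert_if)
        then show False using card_mono[of \<pi> "{A, C, D}"] small A CD by simp
      qed
      then show ?thesis using ab not_both
        by (auto simp: v_def inner_diff_left inner_indicator_vec sum_indicator_vec Int_insert_right)
    qed
    moreover have "v \<noteq> 0"
    proof -
      obtain a where "a \<in> A" using A part by (metis partition_on_def all_not_in_conv)
      then have "v $ a = 1" by (simp add: v_def indicator_vec_def)
      then show ?thesis by auto
    qed
    ultimately show False
      using full_dim_base_polytope_not_in_hyperplane[of \<B> v] full card P by blast
  qed
  then show thesis using that part P_eq by (simp add: thick_partition_def)
qed

text \<open>The hypersimplex belongs to the uniform matroid, whose parallel classes are
  singletons.\<close>

lemma hypersimplex_eq_block_polytope:
  "hypersimplex 2 = block_polytope (range (\<lambda>a :: 'n::finite. {a}))"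
proof -
  have "{A :: 'n set. card A = 2} = {{a, b} | a b. separated (range (\<lambda>a. {a})) a b}"
    by (auto simp: card_2_iff separated_def)
  then show ?thesis
    using block_polytope_eq_base_polytope[OF partition_on_singletons[of "UNIV :: 'n set"]]
    by (simp add: hypersimplex_def base_polytope_def)
qed

lemma block_polytope_subset_hypersimplex: 
  assumes "partition_on UNIV \<pi>"
  shows "block_polytope \<pi> \<subseteq> hypersimplex 2"
  unfolding block_polytope_eq_base_polytope[OF assms] base_polytope_def hypersimplex_def
  using separated_imp_neq[OF assms] by (intro hull_mono image_mono) auto

subsection \<open>Trees of partitions\<close>

text \<open>A partition plays the role of an inner vertex of a tree with leaf set $[n]$; its blocks are the
  leaf sets behind the incident edges, and \<open>A\<close>, \<open>- A\<close> are the two sides of one edge.\<close>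

definition adjacent_in :: "'n set set set \<Rightarrow> 'n set set \<Rightarrow> 'n set set \<Rightarrow> bool" where
  "adjacent_in \<Omega> \<pi> \<rho> \<longleftrightarrow> \<pi> \<in> \<Omega> \<and> \<rho> \<in> \<Omega> \<and> (\<exists>A\<in>\<pi>. - A \<in> \<rho>)"

text \<open>The second clause lets a side of an edge determine its vertex. It speaks of blocks with
  at least two elements because both sides of a wall have that size, by
  \<open>thick_partition_card_Compl_block\<close>.\<close>

definition tree_like :: "'n::finite set set set \<Rightarrow> bool" where
  "tree_like \<Omega> \<longleftrightarrow> (\<forall>\<pi>\<in>\<Omega>. thick_partition \<pi>) \<and>
     (\<forall>\<pi>\<in>\<Omega>. \<forall>\<rho>\<in>\<Omega>. \<forall>A\<in>\<pi>. A \<in> \<rho> \<longrightarrow> 2 \<le> card A \<longrightarrow> \<pi> = \<rho>) \<and>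
     (\<forall>\<pi>\<in>\<Omega>. \<forall>\<rho>\<in>\<Omega>. (adjacent_in \<Omega>)\<^sup>*\<^sup>* \<pi> \<rho>)"

text \<open>Only the end walls are recorded: \<open>S\<close> is crossed when leaving the first
  partition, \<open>T\<close> when entering the last. The condition \<open>U \<noteq> - T\<close>
  forbids turning back through the wall just crossed.\<close>

inductive straight_walk :: "'n set set set \<Rightarrow> 'n set set \<Rightarrow> 'n set \<Rightarrow> 'n set set \<Rightarrow> 'n set \<Rightarrow> bool" for \<Omega> where
  single: "\<pi> \<in> \<Omega> \<Longrightarrow> S \<in> \<pi> \<Longrightarrow> \<rho> \<in> \<Omega> \<Longrightarrow> - S \<in> \<rho> \<Longrightarrow> straight_walk \<Omega> \<pi> S \<rho> S"
| extend: "straight_walk \<Omega> \<pi> S \<rho> T \<Longrightarrow> U \<in> \<rho> \<Longrightarrow> U \<noteq> - T \<Longrightarrow> \<tau> \<in> \<Omega> \<Longrightarrow> - U \<in> \<tau> \<Longrightarrow> straight_walk \<Omega> \<pi> S \<tau> U"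

text \<open>A block of \<open>\<rho>\<close> other than \<open>- T\<close> is disjoint from it and
  so lies in \<open>T\<close>; the crossed blocks decrease.\<close>

lemma straight_walk_nested:
  assumes "straight_walk \<Omega> \<pi> S \<rho> T" and "\<And>\<sigma>. \<sigma> \<in> \<Omega> \<Longrightarrow> partition_on UNIV \<sigma>"
  shows "\<rho> \<in> \<Omega> \<and> S \<in> \<pi> \<and> - T \<in> \<rho> \<and> T \<subseteq> S"
  using assms(1)
proof induction
  case (extend \<pi> S \<rho> T U \<tau>)
  then have "partition_on UNIV \<rho>" "U \<in> \<rho>" "- T \<in> \<rho>" using assms(2) by auto
  then have "U \<subseteq> T" using partition_block_unique[of \<rho> U "- T"] extend.hyps by blast
  then show ?case using extend by auto
qed auto

text \<open>At least two further blocks lie inside \<open>T\<close>.\<close>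

lemma thick_partition_card_Compl_block:
  assumes "thick_partition \<pi>" "- T \<in> \<pi>"
  shows "2 \<le> card T"
proof -
  obtain b c where bc: "b \<notin> - T" "c \<notin> - T" "separated \<pi> b c"
    using thick_partition_separated_outside[OF assms] .
  then have "card {b, c} = 2" using separated_imp_neq[OF thick_partitionD[OF assms(1)]] by simp
  then show ?thesis using card_mono[of T "{b, c}"] bc by simp
qed

text \<open>Backtracking is the only obstruction to extending a straight walk: a step back across the last
  wall returns to the previous partition, since that wall determines the partition on either side.\<close>

lemma straight_walk_exists:
  assumes \<Omega>: "tree_like \<Omega>" and reach: "(adjacent_in \<Omega>)\<^sup>*\<^sup>* \<pi> \<rho>"
  shows "\<rho> = \<pi> \<or> (\<exists>S T. straight_walk \<Omega> \<pi> S \<rho> T)"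
  using reach
proof induction
  case (step \<rho> \<tau>)
  have thick: "thick_partition \<sigma>" if "\<sigma> \<in> \<Omega>" for \<sigma> using \<Omega> that by (auto simp: tree_like_def)
  have unique: "\<sigma> = \<sigma>'" if "\<sigma> \<in> \<Omega>" "\<sigma>' \<in> \<Omega>" "A \<in> \<sigma>" "A \<in> \<sigma>'" "2 \<le> card A" for \<sigma> \<sigma>' A
    using \<Omega> that unfolding tree_like_def by blast
  obtain U where \<tau>: "\<rho> \<in> \<Omega>" "\<tau> \<in> \<Omega>" and U: "U \<in> \<rho>" "- U \<in> \<tau>"
    using step.hyps(2) by (auto simp: adjacent_in_def)
  from step.IH show ?case
  proof
    assume "\<rho> = \<pi>"
    then show ?case using straight_walk.single \<tau> U by blast
  next
    assume "\<exists>S T. straight_walk \<Omega> \<pi> S \<rho> T"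
    then obtain S T where walk: "straight_walk \<Omega> \<pi> S \<rho> T" by blast
    show ?case
    proof (cases "U = - T")
      case False
      then show ?thesis using straight_walk.extend[OF walk] \<tau> U by blast
    next
      case True
      \<comment> \<open>Turning back: \<open>\<tau>\<close> has the block \<open>T\<close>, so it is
        the partition visited before \<open>\<rho>\<close>, either \<open>\<pi>\<close> itself or
        the end of the walk shortened by one step.\<close>
      then have T: "T \<in> \<tau>" "2 \<le> card T"
        using U thick_partition_card_Compl_block[OF thick[OF \<tau>(1)]] by auto
      from walk show ?thesis
      proof cases
        case single
        then show ?thesis using unique[OF \<tau>(2) _ T(1) _ T(2)] by blast
      next
        case (extend \<rho>' T')
        then have "\<rho>' \<in> \<Omega>" using straight_walk_nested[OF _ thick_partitionD[OF thick]] by blast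
        then have "\<tau> = \<rho>'" using unique[OF \<tau>(2) _ T(1) _ T(2)] extend by blast
        then show ?thesis using extend by blast
      qed
    qed
  qed
qed simp

lemma tree_like_face_fitting:
  assumes \<Omega>: "tree_like \<Omega>" and "\<pi> \<in> \<Omega>" "\<rho> \<in> \<Omega>" "\<pi> \<noteq> \<rho>"
  shows "face_fitting (block_polytope \<pi>) (block_polytope \<rho>)"
proof -
  have part: "partition_on UNIV \<sigma>" if "\<sigma> \<in> \<Omega>" for \<sigma>
    using \<Omega> that by (simp add: tree_like_def thick_partition_def)
  have "(adjacent_in \<Omega>)\<^sup>*\<^sup>* \<pi> \<rho>" using assms by (simp add: tree_like_def)
  then obtain S T where "straight_walk \<Omega> \<pi> S \<rho> T"
    using straight_walk_exists[OF \<Omega>] assms(4) by blast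
  then have "S \<in> \<pi>" "- T \<in> \<rho>" "T \<subseteq> S" using straight_walk_nested[OF _ part] by blast+
  then show ?thesis using nested_blocks_face_fitting part assms(2,3) by blast
qed

section \<open>Completing a tree by caps\<close>

definition star_partition :: "'n set \<Rightarrow> 'n set set" where
  "star_partition A = insert (- A) ((\<lambda>a. {a}) ` A)"

lemma thick_star_partition:
  fixes A :: "'n::finite set"
  assumes "2 \<le> card A" "A \<noteq> UNIV"
  shows "thick_partition (star_partition A)"
proof -
  have "partition_on (UNIV - - A) ((\<lambda>a. {a}) ` A)" using partition_on_singletons[of A] by simp
  then have "partition_on UNIV (star_partition A)"
    unfolding star_partition_def using assms(2) by (subst partition_on_insert) (auto simp: disjnt_def)
  moreover have "- A \<notin> (\<lambda>a. {a}) ` A" by auto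
  then have "card (star_partition A) = Suc (card A)"
    by (simp add: star_partition_def card_image)
  ultimately show ?thesis using assms(1) by (simp add: thick_partition_def)
qed

lemma star_partition_large_block:
  "B \<in> star_partition A \<Longrightarrow> 2 \<le> card B \<Longrightarrow> B = - A"
  by (auto simp: star_partition_def)

lemma adjacent_in_sym: "adjacent_in \<Omega> \<pi> \<rho> \<Longrightarrow> adjacent_in \<Omega> \<rho> \<pi>"
  unfolding adjacent_in_def by (metis double_complement)

text \<open>A free side \<open>A\<close> receives \<open>star_partition A\<close>, one vertex
  carrying all leaves of \<open>A\<close>. Its only large block is \<open>- A\<close>, which occurs
  in no old partition, so uniqueness persists. It is adjacent to the old partition with block
  \<open>A\<close>, which also provides the partner for \<open>- A\<close>, so one round of caps
  suffices.\<close>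

lemma tree_like_completion:
  assumes \<Omega>: "tree_like \<Omega>"
  obtains \<Omega>' where "\<Omega> \<subseteq> \<Omega>'" "tree_like \<Omega>'"
    "\<And>\<pi> A. \<pi> \<in> \<Omega>' \<Longrightarrow> A \<in> \<pi> \<Longrightarrow> 2 \<le> card A \<Longrightarrow> \<exists>\<rho>\<in>\<Omega>'. - A \<in> \<rho>"
proof -
  have thick: "thick_partition \<sigma>" if "\<sigma> \<in> \<Omega>" for \<sigma> using \<Omega> that by (auto simp: tree_like_def)
  have unique: "\<sigma> = \<sigma>'" if "\<sigma> \<in> \<Omega>" "\<sigma>' \<in> \<Omega>" "A \<in> \<sigma>" "A \<in> \<sigma>'" "2 \<le> card A" for \<sigma> \<sigma>' A
    using \<Omega> that unfolding tree_like_def by blast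
  define free where "free A \<longleftrightarrow> 2 \<le> card A \<and> (\<exists>\<pi>\<in>\<Omega>. A \<in> \<pi>) \<and> (\<forall>\<rho>\<in>\<Omega>. - A \<notin> \<rho>)" for A
  define \<Omega>' where "\<Omega>' = \<Omega> \<union> star_partition ` {A. free A}"
  have cases: "\<sigma> \<in> \<Omega> \<or> (\<exists>A. free A \<and> \<sigma> = star_partition A)" if "\<sigma> \<in> \<Omega>'" for \<sigma>
    using that by (auto simp: \<Omega>'_def)
  have thick': "thick_partition \<sigma>" if "\<sigma> \<in> \<Omega>'" for \<sigma>
  proof -
    have "A \<noteq> UNIV" if A: "free A" for A
    proof -
      obtain \<pi> where "\<pi> \<in> \<Omega>" "A \<in> \<pi>" using A by (auto simp: free_def)
      then obtain b c where "b \<notin> A" "c \<notin> A" "separated \<pi> b c"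
        using thick thick_partition_separated_outside by metis
      then show ?thesis by blast
    qed
    then show ?thesis using cases[OF that] thick thick_star_partition by (auto simp: free_def)
  qed
  have clash: "False" if "\<sigma> \<in> \<Omega>" "B \<in> \<sigma>" "free A" "B \<in> star_partition A" "2 \<le> card B" for \<sigma> A B
    using that star_partition_large_block[OF that(4,5)] by (auto simp: free_def)
  have unique': "\<sigma> = \<sigma>'" if mem: "\<sigma> \<in> \<Omega>'" "\<sigma>' \<in> \<Omega>'" "B \<in> \<sigma>" "B \<in> \<sigma>'" "2 \<le> card B" for \<sigma> \<sigma>' B
  proof -
    consider "\<sigma> \<in> \<Omega>" "\<sigma>' \<in> \<Omega>" | A where "\<sigma> \<in> \<Omega>" "free A" "\<sigma>' = star_partition A"
      | A where "\<sigma>' \<in> \<Omega>" "free A" "\<sigma> = star_partition A"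
      | A A' where "\<sigma> = star_partition A" "\<sigma>' = star_partition A'"
      using cases[OF mem(1)] cases[OF mem(2)] by blast
    then show ?thesis
    proof cases
      case 4
      then have "- A = - A'" using star_partition_large_block mem(3-5) by metis
      then show ?thesis using 4 by simp
    qed (use unique clash mem in blast)+
  qed
  have mono: "(adjacent_in \<Omega>')\<^sup>*\<^sup>* \<pi> \<rho>" if "(adjacent_in \<Omega>)\<^sup>*\<^sup>* \<pi> \<rho>" for \<pi> \<rho>
    using that by (rule rtranclp_mono[THEN predicate2D, rotated]) (auto simp: adjacent_in_def \<Omega>'_def)
  \<comment> \<open>Each cap is attached to an old partition, so paths between old partitions
    connect everything.\<close>
  have retract: "\<exists>\<pi>\<in>\<Omega>. (adjacent_in \<Omega>')\<^sup>*\<^sup>* \<sigma> \<pi> \<and> (adjacent_in \<Omega>')\<^sup>*\<^sup>* \<pi> \<sigma>" if "\<sigma> \<in> \<Omega>'" for \<sigma>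
    using cases[OF that]
  proof
    assume "\<exists>A. free A \<and> \<sigma> = star_partition A"
    then obtain A \<pi> where A: "\<sigma> = star_partition A" "\<pi> \<in> \<Omega>" "A \<in> \<pi>" by (auto simp: free_def)
    then have "adjacent_in \<Omega>' \<pi> \<sigma>"
      using that by (auto simp: adjacent_in_def \<Omega>'_def star_partition_def)
    then show ?thesis using A(2) adjacent_in_sym by blast
  qed blast
  have "(adjacent_in \<Omega>')\<^sup>*\<^sup>* \<sigma> \<sigma>'" if \<sigma>: "\<sigma> \<in> \<Omega>'" "\<sigma>' \<in> \<Omega>'" for \<sigma> \<sigma>'
  proof -
    obtain \<pi> where \<pi>: "\<pi> \<in> \<Omega>" "(adjacent_in \<Omega>')\<^sup>*\<^sup>* \<sigma> \<pi>" using retract[OF \<sigma>(1)] by blast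
    obtain \<rho> where \<rho>: "\<rho> \<in> \<Omega>" "(adjacent_in \<Omega>')\<^sup>*\<^sup>* \<rho> \<sigma>'" using retract[OF \<sigma>(2)] by blast
    have "(adjacent_in \<Omega>')\<^sup>*\<^sup>* \<pi> \<rho>" using mono \<Omega> \<pi>(1) \<rho>(1) by (auto simp: tree_like_def)
    then show ?thesis using \<pi>(2) \<rho>(2) by (meson rtranclp_trans)
  qed
  then have "tree_like \<Omega>'" using thick' unique' unfolding tree_like_def by blast
  moreover have "\<exists>\<rho>\<in>\<Omega>'. - A \<in> \<rho>" if mem: "\<pi> \<in> \<Omega>'" "A \<in> \<pi>" "2 \<le> card A" for \<pi> A
    using cases[OF mem(1)]
  proof
    assume \<pi>: "\<pi> \<in> \<Omega>"
    show ?thesis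
    proof (cases "free A")
      case True then show ?thesis by (auto simp: \<Omega>'_def star_partition_def)
    next
      case False then show ?thesis using \<pi> mem by (auto simp: \<Omega>'_def free_def)
    qed
  next
    assume "\<exists>A. free A \<and> \<pi> = star_partition A"
    then obtain B where "free B" "A = - B" using star_partition_large_block mem by blast
    then show ?thesis by (auto simp: \<Omega>'_def free_def)
  qed
  ultimately show thesis using that[of \<Omega>'] by (auto simp: \<Omega>'_def)
qed

lemma complete_tree_like_covers:
  assumes \<Omega>: "tree_like \<Omega>" "\<Omega> \<noteq> {}"
    and complete: "\<And>\<pi> A. \<pi> \<in> \<Omega> \<Longrightarrow> A \<in> \<pi> \<Longrightarrow> 2 \<le> card A \<Longrightarrow> \<exists>\<rho>\<in>\<Omega>. - A \<in> \<rho>"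
  shows "(\<Union>\<pi>\<in>\<Omega>. block_polytope \<pi>) = hypersimplex 2"
proof
  have thick: "thick_partition \<sigma>" if "\<sigma> \<in> \<Omega>" for \<sigma> using \<Omega> that by (auto simp: tree_like_def)
  show "(\<Union>\<pi>\<in>\<Omega>. block_polytope \<pi>) \<subseteq> hypersimplex 2"
    using block_polytope_subset_hypersimplex thick_partitionD[OF thick] by blast
  show "hypersimplex 2 \<subseteq> (\<Union>\<pi>\<in>\<Omega>. block_polytope \<pi>)"
  proof (rule subsetI, rule ccontr)
    fix x :: "real ^ 'a" assume "x \<in> hypersimplex 2" and out: "x \<notin> (\<Union>\<pi>\<in>\<Omega>. block_polytope \<pi>)"
    then have x: "x \<in> block_polytope (range (\<lambda>a. {a}))" by (simp add: hypersimplex_eq_block_polytope)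
    have violated: "\<exists>A\<in>\<pi>. 1 < (\<Sum>i\<in>A. x $ i)" if "\<pi> \<in> \<Omega>" for \<pi>
    proof -
      have "x \<notin> block_polytope \<pi>" using out that by blast
      then show ?thesis using x unfolding block_polytope_def by (force simp: not_le)
    qed
    have descent: "False" if "\<pi> \<in> \<Omega>" "A \<in> \<pi>" "1 < (\<Sum>i\<in>A. x $ i)" for \<pi> A
      using that
    proof (induction "card A" arbitrary: A \<pi> rule: less_induct)
      case less
      \<comment> \<open>Coordinates are at most 1, so a violated block has at least two elements and
        therefore a partner across its wall.\<close>
      have "(\<Sum>i\<in>A. x $ i) \<le> real (card A)"
        using x sum_mono[of A "($) x" "\<lambda>_. 1"] by (auto simp: block_polytope_def)
      then have "2 \<le> card A" using less.prems(3) by linarith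
      then obtain \<rho> where \<rho>: "\<rho> \<in> \<Omega>" "- A \<in> \<rho>" using complete less.prems by blast
      obtain B where B: "B \<in> \<rho>" "1 < (\<Sum>i\<in>B. x $ i)" using violated[OF \<rho>(1)] by blast
      \<comment> \<open>The complement has sum 2 - x(A) < 1, so the violated block of
        \<open>\<rho>\<close> is another one and lies inside \<open>A\<close>.\<close>
      have "B \<noteq> - A" using sum_Compl_block_polytope[OF x, of A] less.prems(3) B(2) by auto
      then have "B \<subseteq> A"
        using partition_block_unique[OF thick_partitionD[OF thick[OF \<rho>(1)]] B(1) \<rho>(2)] by blast
      \<comment> \<open>\<open>A\<close> itself is no block of \<open>\<rho>\<close>, because it
        contains two points that \<open>\<rho>\<close> separates.\<close>
      moreover have "B \<noteq> A"
      proof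
        assume "B = A"
        obtain b c where "b \<notin> - A" "c \<notin> - A" "separated \<rho> b c"
          using thick_partition_separated_outside[OF thick[OF \<rho>(1)] \<rho>(2)] .
        then have "b \<in> B" "c \<in> B" "separated \<rho> b c" using \<open>B = A\<close> by auto
        then show False using B(1) by (auto simp: separated_def)
      qed
      ultimately have "card B < card A" by (simp add: psubset_card_mono psubsetI)
      then show False using less.hyps \<rho>(1) B by blast
    qed
    obtain \<pi> where "\<pi> \<in> \<Omega>" using \<Omega>(2) by blast
    then show False using violated descent by blast
  qed
qed

section \<open>Passing between collections of polytopes and trees\<close>

lemma walk_list_iff_rtranclp:
  "(\<exists>Ps. Ps \<noteq> [] \<and> set Ps \<subseteq> \<Sigma> \<and> hd Ps = P \<and> last Ps = Q \<and> successively R Ps)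
    \<longleftrightarrow> P \<in> \<Sigma> \<and> (\<lambda>x y. x \<in> \<Sigma> \<and> y \<in> \<Sigma> \<and> R x y)\<^sup>*\<^sup>* P Q" (is "?L P \<longleftrightarrow> ?R P")
proof
  assume "?L P"
  then obtain Ps where "Ps \<noteq> []" "set Ps \<subseteq> \<Sigma>" "hd Ps = P" "last Ps = Q" "successively R Ps" by blast
  then show "?R P"
  proof (induction Ps arbitrary: P rule: induct_list012)
    case (3 x y zs)
    then have "(\<lambda>x y. x \<in> \<Sigma> \<and> y \<in> \<Sigma> \<and> R x y)\<^sup>*\<^sup>* y Q" by simp
    then show ?case using 3 by (auto intro: converse_rtranclp_into_rtranclp)
  qed auto
next
  assume R: "?R P"
  then have "(\<lambda>x y. x \<in> \<Sigma> \<and> y \<in> \<Sigma> \<and> R x y)\<^sup>*\<^sup>* P Q" "P \<in> \<Sigma>" by blast+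
  then show "?L P"
  proof (induction rule: converse_rtranclp_induct)
    case base
    then show ?case by (intro exI[of _ "[Q]"]) simp
  next
    case (step P P')
    then obtain Ps where "Ps \<noteq> []" "set Ps \<subseteq> \<Sigma>" "hd Ps = P'" "last Ps = Q" "successively R Ps" by blast
    then show ?case using step by (intro exI[of _ "P # Ps"]) (auto simp: successively_Cons)
  qed
qed

text \<open>The closure form of connectedness admits rule induction. Membership is part of the
  relation because the walk must stay in \<open>\<Sigma>\<close>.\<close>

lemma connected_in_codim1_iff:
  "connected_in_codim1 \<Sigma> \<longleftrightarrow>
    (\<forall>P\<in>\<Sigma>. \<forall>Q\<in>\<Sigma>. (\<lambda>P Q. P \<in> \<Sigma> \<and> Q \<in> \<Sigma> \<and> meet_in_common_facet P Q)\<^sup>*\<^sup>* P Q)"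
  unfolding connected_in_codim1_def walk_list_iff_rtranclp by blast

text \<open>\<open>\<Omega>\<close> collects all thick partitions whose polytope belongs to
  \<open>\<Sigma>\<close>. Common facets give adjacency, and the semitiling condition enters through
  \<open>shared_block_imp_eq\<close> as the uniqueness of large blocks.\<close>

lemma tree_like_of_semitiling:
  fixes \<Sigma> :: "(real ^ 'n::finite) set set"
  assumes semi: "semitiling2 \<Sigma>" and conn: "connected_in_codim1 \<Sigma>"
  obtains \<Omega> where "tree_like \<Omega>" "\<Sigma> = block_polytope ` \<Omega>"
proof -
  define \<Omega> where "\<Omega> = {\<pi>. thick_partition \<pi> \<and> block_polytope \<pi> \<in> \<Sigma>}"
  have \<Sigma>: "\<Sigma> = block_polytope ` \<Omega>"
  proof (intro equalityI subsetI)
    fix P assume "P \<in> \<Sigma>"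
    moreover from this have "full_dim_base_polytope 2 P" using semi by (simp add: semitiling2_def)
    ultimately show "P \<in> block_polytope ` \<Omega>"
      by (auto simp: \<Omega>_def elim!: full_dim_base_polytope_imp_block_polytope)
  qed (auto simp: \<Omega>_def)
  have inj: "\<pi> = \<rho>" if "\<pi> \<in> \<Omega>" "\<rho> \<in> \<Omega>" "block_polytope \<pi> = block_polytope \<rho>" for \<pi> \<rho>
    using that block_polytope_inject by (auto simp: \<Omega>_def thick_partition_def)
  \<comment> \<open>The induction runs over polytopes, so the claim is made for every partition with
    the given polytope; injectivity settles the start.\<close>
  have reach: "\<forall>\<rho>\<in>\<Omega>. Q = block_polytope \<rho> \<longrightarrow> (adjacent_in \<Omega>)\<^sup>*\<^sup>* \<pi> \<rho>"
    if "(\<lambda>P Q. P \<in> \<Sigma> \<and> Q \<in> \<Sigma> \<and> meet_in_common_facet P Q)\<^sup>*\<^sup>* (block_polytope \<pi>) Q" "\<pi> \<in> \<Omega>" for \<pi> Q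
    using that(1)
  proof induction
    case base then show ?case using inj that(2) by blast
  next
    case (step P Q)
    then obtain \<sigma> where \<sigma>: "\<sigma> \<in> \<Omega>" "P = block_polytope \<sigma>" using \<Sigma> by blast
    have "adjacent_in \<Omega> \<sigma> \<rho>" if "\<rho> \<in> \<Omega>" "Q = block_polytope \<rho>" for \<rho>
      using meet_in_common_facet_imp_complementary_blocks[of \<sigma> \<rho>] step.hyps \<sigma> that
      by (simp add: adjacent_in_def \<Omega>_def)
    moreover have "(adjacent_in \<Omega>)\<^sup>*\<^sup>* \<pi> \<sigma>" using step.IH \<sigma> by blast
    ultimately show ?case by (blast intro: rtranclp.rtrancl_into_rtrancl)
  qed
  have "tree_like \<Omega>"
    unfolding tree_like_def
  proof (intro conjI ballI impI)
    fix \<pi> \<rho> assume \<pi>: "\<pi> \<in> \<Omega>" "\<rho> \<in> \<Omega>"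
    then show "(adjacent_in \<Omega>)\<^sup>*\<^sup>* \<pi> \<rho>"
      using reach[of \<pi> "block_polytope \<rho>"] conn \<Sigma> unfolding connected_in_codim1_iff by blast
    fix A assume "A \<in> \<pi>" "A \<in> \<rho>" "2 \<le> card A"
    then show "\<pi> = \<rho>"
      using inj[OF \<pi>] shared_block_imp_eq[OF semi, of \<pi> \<rho> A] \<pi> by (simp add: \<Omega>_def)
  qed (simp add: \<Omega>_def)
  then show thesis using that \<Sigma> by blast
qed

lemma tree_like_matroid_tiling:
  fixes \<Omega> :: "'n::finite set set set"
  assumes "tree_like \<Omega>"
  shows "matroid_tiling2 (block_polytope ` \<Omega>)"
proof -
  have "finite (block_polytope ` \<Omega>)" by simp
  moreover have "\<forall>P\<in>block_polytope ` \<Omega>. full_dim_base_polytope 2 P"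
    using assms full_dim_block_polytope by (auto simp: tree_like_def)
  moreover have fit: "pairwise face_fitting (block_polytope ` \<Omega>)"
    using tree_like_face_fitting[OF assms] by (auto simp: pairwise_def)
  moreover have "pairwise face_fitting {P \<in> block_polytope ` \<Omega>. Q face_of P}" for Q
    using fit by (rule pairwise_subset) auto
  ultimately show ?thesis by (simp add: matroid_tiling2_def semitiling2_def)
qed

lemma tree_like_connected_in_codim1:
  fixes \<Omega> :: "'n::finite set set set"
  assumes "tree_like \<Omega>"
  shows "connected_in_codim1 (block_polytope ` \<Omega>)"
proof -
  let ?R = "\<lambda>P Q. P \<in> block_polytope ` \<Omega> \<and> Q \<in> block_polytope ` \<Omega> \<and> meet_in_common_facet P Q"
  have edge: "?R (block_polytope \<pi>) (block_polytope \<rho>)" if "adjacent_in \<Omega> \<pi> \<rho>" for \<pi> \<rho>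
  proof -
    obtain A where "\<pi> \<in> \<Omega>" "\<rho> \<in> \<Omega>" "A \<in> \<pi>" "- A \<in> \<rho>"
      using \<open>adjacent_in \<Omega> \<pi> \<rho>\<close> by (auto simp: adjacent_in_def)
    then show ?thesis
      using complementary_blocks_meet_in_common_facet[of \<pi> \<rho> A] assms by (simp add: tree_like_def)
  qed
  have "?R\<^sup>*\<^sup>* (block_polytope \<pi>) (block_polytope \<rho>)" if "(adjacent_in \<Omega>)\<^sup>*\<^sup>* \<pi> \<rho>" for \<pi> \<rho>
    using that
  proof induction
    case (step \<sigma> \<tau>)
    show ?case by (rule rtranclp.rtrancl_into_rtrancl[OF step.IH edge[OF step.hyps(2)]])
  qed simp
  then show ?thesis
    using assms unfolding connected_in_codim1_iff tree_like_def by blast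
qed

theorem theorem5p1:
  fixes \<Sigma> :: "(real ^ 'n::finite) set set"
  assumes "CARD('n) \<ge> 3"
    and "semitiling2 \<Sigma>"
    and "connected_in_codim1 \<Sigma>"
  shows "\<exists>\<Sigma>'. \<Sigma> \<subseteq> \<Sigma>' \<and> matroid_tiling2 \<Sigma>' \<and> connected_in_codim1 \<Sigma>' \<and> \<Union>\<Sigma>' = hypersimplex 2"
proof -
  have "\<exists>\<Omega> :: 'n set set set. tree_like \<Omega> \<and> \<Omega> \<noteq> {} \<and> \<Sigma> \<subseteq> block_polytope ` \<Omega>"
  proof (cases "\<Sigma> = {}")
    case True
    \<comment> \<open>The empty collection offers no partition to start from; the one into
      singletons serves, and it is thick because \<open>CARD('n) \<ge> 3\<close>.\<close>
    have "card (range (\<lambda>a :: 'n. {a})) = CARD('n)" by (simp add: card_image)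
    then have "tree_like {range (\<lambda>a :: 'n. {a})}"
      using assms(1) partition_on_singletons[of "UNIV :: 'n set"] by (simp add: tree_like_def thick_partition_def)
    then show ?thesis using True by blast
  next
    case False
    obtain \<Omega> where "tree_like \<Omega>" "\<Sigma> = block_polytope ` \<Omega>"
      using tree_like_of_semitiling[OF assms(2,3)] .
    then show ?thesis using False by blast
  qed
  then obtain \<Omega> :: "'n set set set" where \<Omega>: "tree_like \<Omega>" "\<Omega> \<noteq> {}" "\<Sigma> \<subseteq> block_polytope ` \<Omega>" by blast
  obtain \<Omega>' where \<Omega>': "\<Omega> \<subseteq> \<Omega>'" "tree_like \<Omega>'"
    "\<And>\<pi> A. \<pi> \<in> \<Omega>' \<Longrightarrow> A \<in> \<pi> \<Longrightarrow> 2 \<le> card A \<Longrightarrow> \<exists>\<rho>\<in>\<Omega>'. - A \<in> \<rho>"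
    using tree_like_completion[OF \<Omega>(1)] by blast
  have "\<Sigma> \<subseteq> block_polytope ` \<Omega>'" using \<Omega>(3) \<Omega>'(1) by blast
  moreover have "\<Union>(block_polytope ` \<Omega>') = hypersimplex 2"
  proof (rule complete_tree_like_covers[OF \<Omega>'(2)])
    show "\<Omega>' \<noteq> {}" using \<Omega>(2) \<Omega>'(1) by blast
  qed (rule \<Omega>'(3))
  ultimately show ?thesis
    using tree_like_matroid_tiling[OF \<Omega>'(2)] tree_like_connected_in_codim1[OF \<Omega>'(2)] by blast
qed

end
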